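(* Let $\mathscr{C}$ and $\mathscr{D}$ be monoidal categories and let $(F,\phi_2):\mathscr{C}\to\mathscr{D}$ be a strong multiplicative functor admitting a unit compatibility. Then the totality of all unit compatibilities for $F$ (one $\phi_0^{I,J}:J\to F(I)$ for each choice of a unit $I$ in $\mathscr{C}$ and a unit $J$ in $\mathscr{D}$) amounts precisely to a lift of $F$ to a strong multiplicative functor $U(\mathscr{C})\to U(\mathscr{D})$, i.e. a strong multiplicative functor $\widetilde F:U(\mathscr{C})\to U(\mathscr{D})$ such that the square $$\begin{array}{ccc}U(\mathscr{C})&\xrightarrow{\ \widetilde F\ }&U(\mathscr{D})\\ \downarrow&&\downarrow\\ \mathscr{C}&\xrightarrow{\ F\ }&\mathscr{D}\end{array}$$ with the forgetful functors as vertical arrows commutes as a diagram of strong multiplicative functors. That is, sending a lift $\widetilde F$ to the family whose member $\phi_0^{I,J}:J\to F(I)$ is the unique arrow $J\to\widetilde F(I)$ of $U(\mathscr{D})$ is a bijection from the set of such lifts to the set of families $(\phi_0^{I,J})_{I,J}$ of unit compatibilities.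
   Context: A semi-monoidal category is a category with a strictly associative functor $\mathscr{C}\times\mathscr{C}\to\mathscr{C}$, written as juxtaposition. The identity arrow of an object $X$ is also written $X$. An LR unit is a triple $(I,\lambda,\rho)$ with $\lambda_X: IX\to X$, $\rho_X: XI\to X$ natural isomorphisms satisfying, for all $X,Y$: $\lambda_I=\rho_I$; $\lambda_{XY}=\lambda_X Y$; $\rho_{XY}=X\rho_Y$; $X\lambda_Y=\rho_X Y$. A monoidal category is a semi-monoidal category with a unit. A Saavedra unit is a pair $(I,\alpha)$ where $\alpha:II\to I$ is an isomorphism and the functors $X\mapsto IX$ and $X\mapsto XI$ are fully faithful. LR unit structures and Saavedra unit structures on an object $I$ correspond bijectively via $\alpha=\lambda_I=\rho_I$, resp. $I\lambda_X=\alpha X$, $\rho_XI=X\alpha$. $U(\mathscr{C})$ is the category of all LR units of $\mathscr{C}$ (equivalently, all Saavedra units); an arrow $(I,\lambda,\rho)\to(I',\lambda',\rho')$ is an arrow $\psi:I\to I'$ of $\mathscr{C}$ with $\lambda'_X\circ(\psi X)=\lambda_X$ and $\rho'_X\circ(X\psi)=\rho_X$ for all $X$. For a monoidal category, $U(\mathscr{C})$ is contractible: there is exactly one arrow between any two objects. It is semi-monoidal: the product of $(I,\lambda,\rho)$ and $(I',\lambda',\rho')$ is $II'$ with left constraint $\lambda_X\circ(I\lambda'_X):II'X\to X$ and right constraint $\rho'_X\circ(\rho_XI'):XII'\to X$. The forgetful functor $U(\mathscr{C})\to\mathscr{C}$ preserves this product strictly, so it is a strict multiplicative functor. A strong multiplicative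 functor $(F,\phi_2)$ is a functor $F$ with natural isomorphisms $\phi_{X,Y}:F(X)F(Y)\to F(XY)$ such that $\phi_{XY,Z}\circ(\phi_{X,Y}F(Z))=\phi_{X,YZ}\circ(F(X)\phi_{Y,Z})$. Commuting as strong multiplicative functors means that the two composites agree both as functors and in their comparison isomorphisms. For units $I$ of $\mathscr{C}$ and $J$ of $\mathscr{D}$, with corresponding Saavedra structures $\alpha$ and $\beta$, a unit compatibility is an isomorphism $\phi_0:J\to F(I)$ with $\phi_0\circ\beta=F(\alpha)\circ\phi_{I,I}\circ(\phi_0\phi_0)$ (equivalently, $\phi_0$ is compatible with the left and right constraints of $I$ and $J$). *)

theory Defs
  imports "HOL-Library.FuncSet"
begin

section \<open>Semi-monoidal categories\<close>

record ('o, 'a) cat =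
  Obj :: "'o set"
  Arr :: "'a set"
  Dom :: "'a \<Rightarrow> 'o"
  Cod :: "'a \<Rightarrow> 'o"
  Id :: "'o \<Rightarrow> 'a"
  Comp :: "'a \<Rightarrow> 'a \<Rightarrow> 'a"  (infixr "\<cdot>\<index>" 60)

record ('o, 'a) smcat = "('o, 'a) cat" +
  tenso :: "'o \<Rightarrow> 'o \<Rightarrow> 'o"  (infixr "\<odot>\<index>" 70)
  tensa :: "'a \<Rightarrow> 'a \<Rightarrow> 'a"  (infixr "\<otimes>\<index>" 70)

definition hom :: "('o, 'a, 'm) cat_scheme \<Rightarrow> 'o \<Rightarrow> 'o \<Rightarrow> 'a set" where
  "hom C X Y = {f \<in> Arr C. Dom C f = X \<and> Cod C f = Y}"

locale category =
  fixes C (structure)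
  assumes dom_obj: "f \<in> Arr C \<Longrightarrow> Dom C f \<in> Obj C"
    and cod_obj: "f \<in> Arr C \<Longrightarrow> Cod C f \<in> Obj C"
    and id_hom: "X \<in> Obj C \<Longrightarrow> Id C X \<in> hom C X X"
    and comp_hom: "\<lbrakk>g \<in> hom C Y Z; f \<in> hom C X Y\<rbrakk> \<Longrightarrow> g \<cdot> f \<in> hom C X Z"
    and id_left: "f \<in> hom C X Y \<Longrightarrow> Id C Y \<cdot> f = f"
    and id_right: "f \<in> hom C X Y \<Longrightarrow> f \<cdot> Id C X = f"
    and comp_assoc: "\<lbrakk>h \<in> hom C Y Z; g \<in> hom C X Y; f \<in> hom C W X\<rbrakk>
      \<Longrightarrow> (h \<cdot> g) \<cdot> f = h \<cdot> (g \<cdot> f)"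

locale semi_monoidal_category = category C for C (structure) +
  assumes tenso_obj: "\<lbrakk>X \<in> Obj C; Y \<in> Obj C\<rbrakk> \<Longrightarrow> X \<odot> Y \<in> Obj C"
    and tensa_hom: "\<lbrakk>f \<in> hom C X Y; g \<in> hom C X' Y'\<rbrakk> \<Longrightarrow> f \<otimes> g \<in> hom C (X \<odot> X') (Y \<odot> Y')"
    and tensa_id: "\<lbrakk>X \<in> Obj C; Y \<in> Obj C\<rbrakk> \<Longrightarrow> Id C X \<otimes> Id C Y = Id C (X \<odot> Y)"
    and tensa_comp: "\<lbrakk>g \<in> hom C Y Z; f \<in> hom C X Y; g' \<in> hom C Y' Z'; f' \<in> hom C X' Y'\<rbrakk>
      \<Longrightarrow> (g \<cdot> f) \<otimes> (g' \<cdot> f') = (g \<otimes> g') \<cdot> (f \<otimes> f')"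
    and tenso_assoc: "\<lbrakk>X \<in> Obj C; Y \<in> Obj C; Z \<in> Obj C\<rbrakk> \<Longrightarrow> (X \<odot> Y) \<odot> Z = X \<odot> (Y \<odot> Z)"
    and tensa_assoc: "\<lbrakk>f \<in> Arr C; g \<in> Arr C; h \<in> Arr C\<rbrakk> \<Longrightarrow> (f \<otimes> g) \<otimes> h = f \<otimes> (g \<otimes> h)"

definition iso_arr :: "('o, 'a, 'm) cat_scheme \<Rightarrow> 'o \<Rightarrow> 'o \<Rightarrow> 'a \<Rightarrow> bool" where
  "iso_arr C X Y f \<longleftrightarrow> f \<in> hom C X Y \<and>
     (\<exists>g \<in> hom C Y X. Comp C g f = Id C X \<and> Comp C f g = Id C Y)"


section \<open>LR units\<close>

record ('o, 'a) unit_str =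
  uobj :: 'o
  lam :: "'o \<Rightarrow> 'a"
  rho :: "'o \<Rightarrow> 'a"

text \<open>
  The families \<open>lam\<close> and \<open>rho\<close> are indexed by the objects of \<open>C\<close>; being extensional (\<open>undefined\<close> off
  the objects) they are determined by their values there, so that equality of HOL values is equality
  of unit structures. Families indexed by objects are treated in this way throughout.
\<close>

locale lr_unit = semi_monoidal_category C for C (structure) +
  fixes U :: "('o, 'a) unit_str"
  assumes uobj_obj: "uobj U \<in> Obj C"
    and lam_ext: "lam U \<in> extensional (Obj C)"
    and rho_ext: "rho U \<in> extensional (Obj C)"
    and lam_iso: "X \<in> Obj C \<Longrightarrow> iso_arr C (uobj U \<odot> X) X (lam U X)"
    and rho_iso: "X \<in> Obj C \<Longrightarrow> iso_arr C (X \<odot> uobj U) X (rho U X)"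
    and lam_nat: "f \<in> hom C X Y \<Longrightarrow> lam U Y \<cdot> (Id C (uobj U) \<otimes> f) = f \<cdot> lam U X"
    and rho_nat: "f \<in> hom C X Y \<Longrightarrow> rho U Y \<cdot> (f \<otimes> Id C (uobj U)) = f \<cdot> rho U X"
    and lam_rho_unit: "lam U (uobj U) = rho U (uobj U)"
    and lam_tens: "\<lbrakk>X \<in> Obj C; Y \<in> Obj C\<rbrakk> \<Longrightarrow> lam U (X \<odot> Y) = lam U X \<otimes> Id C Y"
    and rho_tens: "\<lbrakk>X \<in> Obj C; Y \<in> Obj C\<rbrakk> \<Longrightarrow> rho U (X \<odot> Y) = Id C X \<otimes> rho U Y"
    and lam_rho: "\<lbrakk>X \<in> Obj C; Y \<in> Obj C\<rbrakk> \<Longrightarrow> Id C X \<otimes> lam U Y = rho U X \<otimes> Id C Y"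

locale monoidal_category = semi_monoidal_category C for C (structure) +
  assumes has_unit: "\<exists>U. lr_unit C U"

text \<open>The arrow \<open>\<alpha> : II \<rightarrow> I\<close> of the Saavedra unit corresponding to an LR unit.\<close>

definition saavedra_arr :: "('o, 'a) unit_str \<Rightarrow> 'a" where
  "saavedra_arr U = lam U (uobj U)"


section \<open>The semi-monoidal category of units\<close>

definition unit_arr :: "('o, 'a) smcat \<Rightarrow> ('o, 'a) unit_str \<Rightarrow> ('o, 'a) unit_str \<Rightarrow> 'a \<Rightarrow> bool" where
  "unit_arr C U V p \<longleftrightarrow> p \<in> hom C (uobj U) (uobj V) \<and>
     (\<forall>X \<in> Obj C. lam V X \<cdot>\<^bsub>C\<^esub> (p \<otimes>\<^bsub>C\<^esub> Id C X) = lam U X) \<and>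
     (\<forall>X \<in> Obj C. rho V X \<cdot>\<^bsub>C\<^esub> (Id C X \<otimes>\<^bsub>C\<^esub> p) = rho U X)"

definition unit_tens :: "('o, 'a) smcat \<Rightarrow> ('o, 'a) unit_str \<Rightarrow> ('o, 'a) unit_str \<Rightarrow> ('o, 'a) unit_str" where
  "unit_tens C U V =
     \<lparr>uobj = uobj U \<odot>\<^bsub>C\<^esub> uobj V,
      lam = (\<lambda>X \<in> Obj C. lam U X \<cdot>\<^bsub>C\<^esub> (Id C (uobj U) \<otimes>\<^bsub>C\<^esub> lam V X)),
      rho = (\<lambda>X \<in> Obj C. rho V X \<cdot>\<^bsub>C\<^esub> (rho U X \<otimes>\<^bsub>C\<^esub> Id C (uobj V)))\<rparr>"

text \<open>
  An arrow \<open>U \<rightarrow> V\<close> of the category of units is encoded as a triple \<open>(U, p, V)\<close>, since \<open>p\<close> alone does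
  not determine the unit structures on its source and target.
\<close>

definition units :: "('o, 'a) smcat \<Rightarrow>
    (('o, 'a) unit_str, ('o, 'a) unit_str \<times> 'a \<times> ('o, 'a) unit_str) smcat" where
  "units C =
     \<lparr>Obj = {U. lr_unit C U},
      Arr = {(U, p, V). lr_unit C U \<and> lr_unit C V \<and> unit_arr C U V p},
      Dom = (\<lambda>(U, p, V). U),
      Cod = (\<lambda>(U, p, V). V),
      Id = (\<lambda>U. (U, Id C (uobj U), U)),
      Comp = (\<lambda>(V', q, W) (U, p, V). (U, q \<cdot>\<^bsub>C\<^esub> p, W)),
      tenso = unit_tens C,
      tensa = (\<lambda>(U, p, V) (U', p', V'). (unit_tens C U U', p \<otimes>\<^bsub>C\<^esub> p', unit_tens C V V'))\<rparr>"


section \<open>Strong multiplicative functors\<close>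

record ('o, 'a, 'p, 'b) mult_fun =
  on_obj :: "'o \<Rightarrow> 'p"
  on_arr :: "'a \<Rightarrow> 'b"
  cmp :: "'o \<times> 'o \<Rightarrow> 'b"

locale strong_mult_functor =
  fixes C :: "('o, 'a) smcat" and D :: "('p, 'b) smcat" and F :: "('o, 'a, 'p, 'b) mult_fun"
  assumes obj_ext: "on_obj F \<in> extensional (Obj C)"
    and arr_ext: "on_arr F \<in> extensional (Arr C)"
    and cmp_ext: "cmp F \<in> extensional (Obj C \<times> Obj C)"
    and obj_map: "X \<in> Obj C \<Longrightarrow> on_obj F X \<in> Obj D"
    and arr_map: "f \<in> hom C X Y \<Longrightarrow> on_arr F f \<in> hom D (on_obj F X) (on_obj F Y)"
    and map_id: "X \<in> Obj C \<Longrightarrow> on_arr F (Id C X) = Id D (on_obj F X)"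
    and map_comp: "\<lbrakk>g \<in> hom C Y Z; f \<in> hom C X Y\<rbrakk>
      \<Longrightarrow> on_arr F (g \<cdot>\<^bsub>C\<^esub> f) = on_arr F g \<cdot>\<^bsub>D\<^esub> on_arr F f"
    and cmp_iso: "\<lbrakk>X \<in> Obj C; Y \<in> Obj C\<rbrakk>
      \<Longrightarrow> iso_arr D (on_obj F X \<odot>\<^bsub>D\<^esub> on_obj F Y) (on_obj F (X \<odot>\<^bsub>C\<^esub> Y)) (cmp F (X, Y))"
    and cmp_nat: "\<lbrakk>f \<in> hom C X X'; g \<in> hom C Y Y'\<rbrakk>
      \<Longrightarrow> cmp F (X', Y') \<cdot>\<^bsub>D\<^esub> (on_arr F f \<otimes>\<^bsub>D\<^esub> on_arr F g)
          = on_arr F (f \<otimes>\<^bsub>C\<^esub> g) \<cdot>\<^bsub>D\<^esub> cmp F (X, Y)"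
    and cmp_assoc: "\<lbrakk>X \<in> Obj C; Y \<in> Obj C; Z \<in> Obj C\<rbrakk>
      \<Longrightarrow> cmp F (X \<odot>\<^bsub>C\<^esub> Y, Z) \<cdot>\<^bsub>D\<^esub> (cmp F (X, Y) \<otimes>\<^bsub>D\<^esub> Id D (on_obj F Z))
          = cmp F (X, Y \<odot>\<^bsub>C\<^esub> Z) \<cdot>\<^bsub>D\<^esub> (Id D (on_obj F X) \<otimes>\<^bsub>D\<^esub> cmp F (Y, Z))"

text \<open>
  The composite of \<open>(F, \<phi>) : C \<rightarrow> D\<close> and \<open>(G, \<gamma>) : D \<rightarrow> E\<close> has comparison isomorphisms
  \<open>GF(X) GF(Y) \<rightarrow> G(F(X) F(Y)) \<rightarrow> GF(XY)\<close>.
\<close>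

definition mult_fun_comp :: "('o, 'a) smcat \<Rightarrow> ('q, 'c) smcat \<Rightarrow> ('p, 'b, 'q, 'c) mult_fun \<Rightarrow>
    ('o, 'a, 'p, 'b) mult_fun \<Rightarrow> ('o, 'a, 'q, 'c) mult_fun" where
  "mult_fun_comp C E G F =
     \<lparr>on_obj = (\<lambda>X \<in> Obj C. on_obj G (on_obj F X)),
      on_arr = (\<lambda>f \<in> Arr C. on_arr G (on_arr F f)),
      cmp = (\<lambda>(X, Y) \<in> Obj C \<times> Obj C.
        on_arr G (cmp F (X, Y)) \<cdot>\<^bsub>E\<^esub> cmp G (on_obj F X, on_obj F Y))\<rparr>"

text \<open>The forgetful functor is strict: its comparison isomorphisms are identities.\<close>

definition forgetful :: "('o, 'a) smcat \<Rightarrow>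
    (('o, 'a) unit_str, ('o, 'a) unit_str \<times> 'a \<times> ('o, 'a) unit_str, 'o, 'a) mult_fun" where
  "forgetful C =
     \<lparr>on_obj = (\<lambda>U \<in> Obj (units C). uobj U),
      on_arr = (\<lambda>(U, p, V) \<in> Arr (units C). p),
      cmp = (\<lambda>(U, V) \<in> Obj (units C) \<times> Obj (units C). Id C (uobj U \<odot>\<^bsub>C\<^esub> uobj V))\<rparr>"


section \<open>Basic facts on the category of units\<close>

text \<open>
  \<open>units_semi_monoidal\<close> and \<open>forgetful_strong_mult_functor\<close> show that the constructions above are of
  the required kind; \<open>units_contractible\<close> shows that the definite description in \<open>lift_family\<close> below
  denotes.
\<close>

context semi_monoidal_category begin

lemma hom_objD: "f \<in> hom C X Y \<Longrightarrow> X \<in> Obj C \<and> Y \<in> Obj C"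
  using dom_obj cod_obj by (auto simp: hom_def)

lemma hom_arr: "f \<in> hom C X Y \<Longrightarrow> f \<in> Arr C"
  by (simp add: hom_def)

lemma tensa_assoc_hom:
  "\<lbrakk>f \<in> hom C X X'; g \<in> hom C Y Y'; h \<in> hom C Z Z'\<rbrakk> \<Longrightarrow> (f \<otimes> g) \<otimes> h = f \<otimes> (g \<otimes> h)"
  by (simp add: tensa_assoc hom_arr)

lemma whisker_left:
  assumes "g \<in> hom C Y Z" "f \<in> hom C X Y" "W \<in> Obj C"
  shows "Id C W \<otimes> (g \<cdot> f) = (Id C W \<otimes> g) \<cdot> (Id C W \<otimes> f)"
  using tensa_comp[OF id_hom[OF assms(3)] id_hom[OF assms(3)] assms(1,2)] id_left[OF id_hom[OF assms(3)]]
  by simp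

lemma whisker_right:
  assumes "g \<in> hom C Y Z" "f \<in> hom C X Y" "W \<in> Obj C"
  shows "(g \<cdot> f) \<otimes> Id C W = (g \<otimes> Id C W) \<cdot> (f \<otimes> Id C W)"
  using tensa_comp[OF assms(1,2) id_hom[OF assms(3)] id_hom[OF assms(3)]] id_left[OF id_hom[OF assms(3)]]
  by simp

lemma interchange1:
  assumes "f \<in> hom C X X'" "g \<in> hom C Y Y'"
  shows "(f \<otimes> Id C Y') \<cdot> (Id C X \<otimes> g) = f \<otimes> g"
  using tensa_comp[OF assms(1) id_hom id_hom assms(2)] id_left[OF assms(2)] id_right[OF assms(1)] hom_objD[OF assms(1)] hom_objD[OF assms(2)]
  by simp

lemma interchange2:
  assumes "f \<in> hom C X X'" "g \<in> hom C Y Y'"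
  shows "(Id C X' \<otimes> g) \<cdot> (f \<otimes> Id C Y) = f \<otimes> g"
  using tensa_comp[OF id_hom assms(1) assms(2) id_hom] id_left[OF assms(1)] id_right[OF assms(2)] hom_objD[OF assms(1)] hom_objD[OF assms(2)]
  by simp

lemma iso_comp:
  assumes "iso_arr C Y Z g" "iso_arr C X Y f" shows "iso_arr C X Z (g \<cdot> f)"
proof -
  obtain g' f' where g: "g \<in> hom C Y Z" "g' \<in> hom C Z Y" "g' \<cdot> g = Id C Y" "g \<cdot> g' = Id C Z"
    and f: "f \<in> hom C X Y" "f' \<in> hom C Y X" "f' \<cdot> f = Id C X" "f \<cdot> f' = Id C Y"
    using assms by (auto simp: iso_arr_def)
  have "(f' \<cdot> g') \<cdot> (g \<cdot> f) = Id C X"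
    using comp_assoc[OF f(2) g(2) comp_hom[OF g(1) f(1)]] comp_assoc[OF g(2) g(1) f(1)]
      f g id_left[OF f(1)] by simp
  moreover have "(g \<cdot> f) \<cdot> (f' \<cdot> g') = Id C Z"
    using comp_assoc[OF g(1) f(1) comp_hom[OF f(2) g(2)]] comp_assoc[OF f(1) f(2) g(2)]
      f g id_left[OF g(2)] by simp
  ultimately show ?thesis
    using comp_hom[OF g(1) f(1)] comp_hom[OF f(2) g(2)] by (auto simp: iso_arr_def)
qed

lemma iso_tens:
  assumes "iso_arr C X Y f" "iso_arr C X' Y' f'" shows "iso_arr C (X \<odot> X') (Y \<odot> Y') (f \<otimes> f')"
proof -
  obtain g g' where f: "f \<in> hom C X Y" "g \<in> hom C Y X" "g \<cdot> f = Id C X" "f \<cdot> g = Id C Y"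
    and f': "f' \<in> hom C X' Y'" "g' \<in> hom C Y' X'" "g' \<cdot> f' = Id C X'" "f' \<cdot> g' = Id C Y'"
    using assms by (auto simp: iso_arr_def)
  have "(g \<otimes> g') \<cdot> (f \<otimes> f') = Id C (X \<odot> X')"
    using tensa_comp[OF f(2,1) f'(2,1)] f f' hom_objD[OF f(1)] hom_objD[OF f'(1)] by (simp add: tensa_id)
  moreover have "(f \<otimes> f') \<cdot> (g \<otimes> g') = Id C (Y \<odot> Y')"
    using tensa_comp[OF f(1,2) f'(1,2)] f f' hom_objD[OF f(1)] hom_objD[OF f'(1)] by (simp add: tensa_id)
  ultimately show ?thesis
    using tensa_hom[OF f(1) f'(1)] tensa_hom[OF f(2) f'(2)] by (auto simp: iso_arr_def)
qed

lemma iso_id: "X \<in> Obj C \<Longrightarrow> iso_arr C X X (Id C X)"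
  using id_hom id_left[OF id_hom] by (auto simp: iso_arr_def)

lemma iso_epi:
  assumes "iso_arr C X Y f" "g \<in> hom C Y Z" "h \<in> hom C Y Z" "g \<cdot> f = h \<cdot> f" shows "g = h"
proof -
  obtain k where k: "f \<in> hom C X Y" "k \<in> hom C Y X" "f \<cdot> k = Id C Y"
    using assms(1) by (auto simp: iso_arr_def)
  have "g = (g \<cdot> f) \<cdot> k" "h = (h \<cdot> f) \<cdot> k"
    using comp_assoc[OF assms(2) k(1,2)] comp_assoc[OF assms(3) k(1,2)] k(3)
      id_right[OF assms(2)] id_right[OF assms(3)] by simp_all
  then show ?thesis using assms(4) by simp
qed

lemma iso_mono:
  assumes "iso_arr C X Y f" "g \<in> hom C Z X" "h \<in> hom C Z X" "f \<cdot> g = f \<cdot> h" shows "g = h"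
proof -
  obtain k where k: "f \<in> hom C X Y" "k \<in> hom C Y X" "k \<cdot> f = Id C X"
    using assms(1) by (auto simp: iso_arr_def)
  have "g = k \<cdot> (f \<cdot> g)" "h = k \<cdot> (f \<cdot> h)"
    using comp_assoc[OF k(2,1) assms(2)] comp_assoc[OF k(2,1) assms(3)] k(3)
      id_left[OF assms(2)] id_left[OF assms(3)] by simp_all
  then show ?thesis using assms(4) by simp
qed

lemma iso_hom: "iso_arr C X Y f \<Longrightarrow> f \<in> hom C X Y"
  by (simp add: iso_arr_def)

end

context lr_unit begin
lemmas lam_hom = iso_hom[OF lam_iso]
lemmas rho_hom = iso_hom[OF rho_iso]
end

lemma unit_tens_lr_unit:
  assumes "lr_unit C U" "lr_unit C V"
  shows "lr_unit C (unit_tens C U V)"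
proof -
  interpret U: lr_unit C U by fact
  interpret V: lr_unit C V by fact
  let ?I = "uobj U" and ?J = "uobj V" and ?W = "unit_tens C U V"
  note [simp] = U.uobj_obj V.uobj_obj U.tenso_obj U.id_hom
  have I: "?I \<in> Obj C" and J: "?J \<in> Obj C" by simp_all
  have uW: "uobj ?W = ?I \<odot>\<^bsub>C\<^esub> ?J" by (simp add: unit_tens_def)
  have lW: "lam ?W X = lam U X \<cdot>\<^bsub>C\<^esub> (Id C ?I \<otimes>\<^bsub>C\<^esub> lam V X)" if "X \<in> Obj C" for X
    using that by (simp add: unit_tens_def)
  have rW: "rho ?W X = rho V X \<cdot>\<^bsub>C\<^esub> (rho U X \<otimes>\<^bsub>C\<^esub> Id C ?J)" if "X \<in> Obj C" for X
    using that by (simp add: unit_tens_def)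
  have lr: "Id C X \<otimes>\<^bsub>C\<^esub> lam ?W Y = rho ?W X \<otimes>\<^bsub>C\<^esub> Id C Y" if X: "X \<in> Obj C" and Y: "Y \<in> Obj C" for X Y
  proof -
    have "Id C X \<otimes>\<^bsub>C\<^esub> lam ?W Y = (Id C X \<otimes>\<^bsub>C\<^esub> lam U Y) \<cdot>\<^bsub>C\<^esub> (Id C X \<otimes>\<^bsub>C\<^esub> (Id C ?I \<otimes>\<^bsub>C\<^esub> lam V Y))"
      unfolding lW[OF Y]
      by (rule U.whisker_left[OF U.lam_hom[OF Y] U.tensa_hom[OF U.id_hom[OF I] V.lam_hom[OF Y]] X])
    also have "Id C X \<otimes>\<^bsub>C\<^esub> (Id C ?I \<otimes>\<^bsub>C\<^esub> lam V Y) = (Id C X \<otimes>\<^bsub>C\<^esub> Id C ?I) \<otimes>\<^bsub>C\<^esub> lam V Y"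
      using U.tensa_assoc_hom[OF U.id_hom[OF X] U.id_hom[OF I] V.lam_hom[OF Y]] by simp
    also have "\<dots> = rho V (X \<odot>\<^bsub>C\<^esub> ?I) \<otimes>\<^bsub>C\<^esub> Id C Y"
      using X Y by (simp add: U.tensa_id V.lam_rho)
    also have "Id C X \<otimes>\<^bsub>C\<^esub> lam U Y = rho U X \<otimes>\<^bsub>C\<^esub> Id C Y"
      using X Y by (rule U.lam_rho)
    also have "(rho U X \<otimes>\<^bsub>C\<^esub> Id C Y) \<cdot>\<^bsub>C\<^esub> (rho V (X \<odot>\<^bsub>C\<^esub> ?I) \<otimes>\<^bsub>C\<^esub> Id C Y)
      = (rho U X \<cdot>\<^bsub>C\<^esub> rho V (X \<odot>\<^bsub>C\<^esub> ?I)) \<otimes>\<^bsub>C\<^esub> Id C Y"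
      by (rule U.whisker_right[OF U.rho_hom[OF X] V.rho_hom Y, symmetric]) (use X in simp)
    also have "rho U X \<cdot>\<^bsub>C\<^esub> rho V (X \<odot>\<^bsub>C\<^esub> ?I) = rho ?W X"
      unfolding rW[OF X] by (rule V.rho_nat[OF U.rho_hom[OF X], symmetric])
    finally show ?thesis .
  qed
  show ?thesis
  proof unfold_locales
    show "uobj ?W \<in> Obj C" by (simp add: uW)
    show "lam ?W \<in> extensional (Obj C)" "rho ?W \<in> extensional (Obj C)"
      by (auto simp: unit_tens_def)
    show "iso_arr C (uobj ?W \<odot>\<^bsub>C\<^esub> X) X (lam ?W X)" if "X \<in> Obj C" for X
      unfolding uW lW[OF that] U.tenso_assoc[OF I J that]
      by (intro U.iso_comp[OF U.lam_iso U.iso_tens[OF U.iso_id V.lam_iso]] that I)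
    show "iso_arr C (X \<odot>\<^bsub>C\<^esub> uobj ?W) X (rho ?W X)" if "X \<in> Obj C" for X
      unfolding uW rW[OF that] U.tenso_assoc[OF that I J, symmetric]
      by (intro U.iso_comp[OF V.rho_iso U.iso_tens[OF U.rho_iso U.iso_id]] that J)
    show "lam ?W Y \<cdot>\<^bsub>C\<^esub> (Id C (uobj ?W) \<otimes>\<^bsub>C\<^esub> f) = f \<cdot>\<^bsub>C\<^esub> lam ?W X" if f: "f \<in> hom C X Y" for f X Y
    proof -
      have X: "X \<in> Obj C" and Y: "Y \<in> Obj C" using U.hom_objD[OF f] by auto
      have lVX: "lam V X \<in> hom C (?J \<odot>\<^bsub>C\<^esub> X) X" and lVY: "lam V Y \<in> hom C (?J \<odot>\<^bsub>C\<^esub> Y) Y"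
        using X Y V.lam_hom by auto
      have If: "Id C ?J \<otimes>\<^bsub>C\<^esub> f \<in> hom C (?J \<odot>\<^bsub>C\<^esub> X) (?J \<odot>\<^bsub>C\<^esub> Y)" 
        by (intro U.tensa_hom U.id_hom J f)
      have "Id C (uobj ?W) \<otimes>\<^bsub>C\<^esub> f = Id C ?I \<otimes>\<^bsub>C\<^esub> (Id C ?J \<otimes>\<^bsub>C\<^esub> f)"
        unfolding uW U.tensa_id[OF I J, symmetric] by (rule U.tensa_assoc_hom[OF U.id_hom[OF I] U.id_hom[OF J] f])
      then have "lam ?W Y \<cdot>\<^bsub>C\<^esub> (Id C (uobj ?W) \<otimes>\<^bsub>C\<^esub> f)
        = lam U Y \<cdot>\<^bsub>C\<^esub> ((Id C ?I \<otimes>\<^bsub>C\<^esub> lam V Y) \<cdot>\<^bsub>C\<^esub> (Id C ?I \<otimes>\<^bsub>C\<^esub> (Id C ?J \<otimes>\<^bsub>C\<^esub> f)))"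
        unfolding lW[OF Y]
        using U.comp_assoc[OF U.lam_hom[OF Y] U.tensa_hom[OF U.id_hom[OF I] lVY] U.tensa_hom[OF U.id_hom[OF I] If]]
        by simp
      also have "\<dots> = lam U Y \<cdot>\<^bsub>C\<^esub> (Id C ?I \<otimes>\<^bsub>C\<^esub> (f \<cdot>\<^bsub>C\<^esub> lam V X))"
        using U.whisker_left[OF lVY If I] V.lam_nat[OF f] by simp
      also have "\<dots> = lam U Y \<cdot>\<^bsub>C\<^esub> ((Id C ?I \<otimes>\<^bsub>C\<^esub> f) \<cdot>\<^bsub>C\<^esub> (Id C ?I \<otimes>\<^bsub>C\<^esub> lam V X))"
        using U.whisker_left[OF f lVX I] by simp
      also have "\<dots> = (f \<cdot>\<^bsub>C\<^esub> lam U X) \<cdot>\<^bsub>C\<^esub> (Id C ?I \<otimes>\<^bsub>C\<^esub> lam V X)"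
        using U.comp_assoc[OF U.lam_hom[OF Y] U.tensa_hom[OF U.id_hom[OF I] f] U.tensa_hom[OF U.id_hom[OF I] lVX]]
          U.lam_nat[OF f] by simp
      also have "\<dots> = f \<cdot>\<^bsub>C\<^esub> lam ?W X"
        unfolding lW[OF X] by (rule U.comp_assoc[OF f U.lam_hom[OF X] U.tensa_hom[OF U.id_hom[OF I] lVX]])
      finally show ?thesis .
    qed
    show "rho ?W Y \<cdot>\<^bsub>C\<^esub> (f \<otimes>\<^bsub>C\<^esub> Id C (uobj ?W)) = f \<cdot>\<^bsub>C\<^esub> rho ?W X" if f: "f \<in> hom C X Y" for f X Y
    proof -
      have X: "X \<in> Obj C" and Y: "Y \<in> Obj C" using U.hom_objD[OF f] by auto
      have lVX: "rho U X \<in> hom C (X \<odot>\<^bsub>C\<^esub> ?I) X" and lVY: "rho U Y \<in> hom C (Y \<odot>\<^bsub>C\<^esub> ?I) Y"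
        using X Y U.rho_hom by auto
      have If: "f \<otimes>\<^bsub>C\<^esub> Id C ?I \<in> hom C (X \<odot>\<^bsub>C\<^esub> ?I) (Y \<odot>\<^bsub>C\<^esub> ?I)" 
        by (intro U.tensa_hom U.id_hom I f)
      have "f \<otimes>\<^bsub>C\<^esub> Id C (uobj ?W) = (f \<otimes>\<^bsub>C\<^esub> Id C ?I) \<otimes>\<^bsub>C\<^esub> Id C ?J"
        unfolding uW U.tensa_id[OF I J, symmetric]
        by (rule U.tensa_assoc_hom[OF f U.id_hom[OF I] U.id_hom[OF J], symmetric])
      then have "rho ?W Y \<cdot>\<^bsub>C\<^esub> (f \<otimes>\<^bsub>C\<^esub> Id C (uobj ?W))
        = rho V Y \<cdot>\<^bsub>C\<^esub> ((rho U Y \<otimes>\<^bsub>C\<^esub> Id C ?J) \<cdot>\<^bsub>C\<^esub> ((f \<otimes>\<^bsub>C\<^esub> Id C ?I) \<otimes>\<^bsub>C\<^esub> Id C ?J))"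
        unfolding rW[OF Y]
        using U.comp_assoc[OF V.rho_hom[OF Y] U.tensa_hom[OF lVY U.id_hom[OF J]] U.tensa_hom[OF If U.id_hom[OF J]]]
        by simp
      also have "\<dots> = rho V Y \<cdot>\<^bsub>C\<^esub> ((f \<cdot>\<^bsub>C\<^esub> rho U X) \<otimes>\<^bsub>C\<^esub> Id C ?J)"
        using U.whisker_right[OF lVY If J] U.rho_nat[OF f] by simp
      also have "\<dots> = rho V Y \<cdot>\<^bsub>C\<^esub> ((f \<otimes>\<^bsub>C\<^esub> Id C ?J) \<cdot>\<^bsub>C\<^esub> (rho U X \<otimes>\<^bsub>C\<^esub> Id C ?J))"
        using U.whisker_right[OF f lVX J] by simp
      also have "\<dots> = (f \<cdot>\<^bsub>C\<^esub> rho V X) \<cdot>\<^bsub>C\<^esub> (rho U X \<otimes>\<^bsub>C\<^esub> Id C ?J)"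
        using U.comp_assoc[OF V.rho_hom[OF Y] U.tensa_hom[OF f U.id_hom[OF J]] U.tensa_hom[OF lVX U.id_hom[OF J]]]
          V.rho_nat[OF f] by simp
      also have "\<dots> = f \<cdot>\<^bsub>C\<^esub> rho ?W X"
        unfolding rW[OF X] by (rule U.comp_assoc[OF f V.rho_hom[OF X] U.tensa_hom[OF lVX U.id_hom[OF J]]])
      finally show ?thesis .
    qed
    show lt: "lam ?W (X \<odot>\<^bsub>C\<^esub> Y) = lam ?W X \<otimes>\<^bsub>C\<^esub> Id C Y" if X: "X \<in> Obj C" and Y: "Y \<in> Obj C" for X Y
    proof -
      have XY: "X \<odot>\<^bsub>C\<^esub> Y \<in> Obj C" using X Y by simp
      have "lam ?W (X \<odot>\<^bsub>C\<^esub> Y) = (lam U X \<otimes>\<^bsub>C\<^esub> Id C Y) \<cdot>\<^bsub>C\<^esub> ((Id C ?I \<otimes>\<^bsub>C\<^esub> lam V X) \<otimes>\<^bsub>C\<^esub> Id C Y)"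
        unfolding lW[OF XY] U.lam_tens[OF X Y] V.lam_tens[OF X Y]
        using U.tensa_assoc_hom[OF U.id_hom[OF I] V.lam_hom[OF X] U.id_hom[OF Y]] by simp
      also have "\<dots> = lam ?W X \<otimes>\<^bsub>C\<^esub> Id C Y"
        unfolding lW[OF X]
        by (rule U.whisker_right[OF U.lam_hom[OF X] U.tensa_hom[OF U.id_hom[OF I] V.lam_hom[OF X]] Y, symmetric])
      finally show ?thesis .
    qed
    show rt: "rho ?W (X \<odot>\<^bsub>C\<^esub> Y) = Id C X \<otimes>\<^bsub>C\<^esub> rho ?W Y" if X: "X \<in> Obj C" and Y: "Y \<in> Obj C" for X Y
    proof -
      have XY: "X \<odot>\<^bsub>C\<^esub> Y \<in> Obj C" using X Y by simp
      have "rho ?W (X \<odot>\<^bsub>C\<^esub> Y) = (Id C X \<otimes>\<^bsub>C\<^esub> rho V Y) \<cdot>\<^bsub>C\<^esub> (Id C X \<otimes>\<^bsub>C\<^esub> (rho U Y \<otimes>\<^bsub>C\<^esub> Id C ?J))"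
        unfolding rW[OF XY] U.rho_tens[OF X Y] V.rho_tens[OF X Y]
        using U.tensa_assoc_hom[OF U.id_hom[OF X] U.rho_hom[OF Y] U.id_hom[OF J]] by simp
      also have "\<dots> = Id C X \<otimes>\<^bsub>C\<^esub> rho ?W Y"
        unfolding rW[OF Y]
        by (rule U.whisker_left[OF V.rho_hom[OF Y] U.tensa_hom[OF U.rho_hom[OF Y] U.id_hom[OF J]] X, symmetric])
      finally show ?thesis .
    qed
    show "Id C X \<otimes>\<^bsub>C\<^esub> lam ?W Y = rho ?W X \<otimes>\<^bsub>C\<^esub> Id C Y" if "X \<in> Obj C" "Y \<in> Obj C" for X Y
      using that by (rule lr)
    show "lam ?W (uobj ?W) = rho ?W (uobj ?W)"
    proof -
      let ?IJ = "?I \<odot>\<^bsub>C\<^esub> ?J"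
      have IJ: "?IJ \<in> Obj C" by simp
      have "lam ?W ?IJ = (lam U ?I \<otimes>\<^bsub>C\<^esub> Id C ?J) \<cdot>\<^bsub>C\<^esub> (Id C ?I \<otimes>\<^bsub>C\<^esub> lam V ?IJ)"
        unfolding lW[OF IJ] U.lam_tens[OF I J] ..
      also have "\<dots> = (Id C ?I \<otimes>\<^bsub>C\<^esub> lam U ?J) \<cdot>\<^bsub>C\<^esub> (rho V ?I \<otimes>\<^bsub>C\<^esub> Id C ?IJ)"
        using U.lam_rho[OF I J] V.lam_rho[OF I IJ] U.lam_rho_unit by simp
      also have "rho V ?I \<otimes>\<^bsub>C\<^esub> Id C ?IJ = (rho V ?I \<otimes>\<^bsub>C\<^esub> Id C ?I) \<otimes>\<^bsub>C\<^esub> Id C ?J"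
        unfolding U.tensa_id[OF I J, symmetric]
        by (rule U.tensa_assoc_hom[OF V.rho_hom[OF I] U.id_hom[OF I] U.id_hom[OF J], symmetric])
      also have "\<dots> = (Id C ?I \<otimes>\<^bsub>C\<^esub> lam V ?I) \<otimes>\<^bsub>C\<^esub> Id C ?J"
        using V.lam_rho[OF I I] by simp
      also have "\<dots> = Id C ?I \<otimes>\<^bsub>C\<^esub> lam V ?IJ"
        using U.tensa_assoc_hom[OF U.id_hom[OF I] V.lam_hom[OF I] U.id_hom[OF J]] V.lam_tens[OF I J] by simp
      finally have A: "lam ?W ?IJ = (Id C ?I \<otimes>\<^bsub>C\<^esub> lam U ?J) \<cdot>\<^bsub>C\<^esub> (Id C ?I \<otimes>\<^bsub>C\<^esub> lam V ?IJ)" .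
      have "rho ?W ?IJ = (Id C ?I \<otimes>\<^bsub>C\<^esub> lam V ?J) \<cdot>\<^bsub>C\<^esub> (rho U ?IJ \<otimes>\<^bsub>C\<^esub> Id C ?J)"
        unfolding rW[OF IJ] V.rho_tens[OF I J] V.lam_rho_unit ..
      also have "rho U ?IJ \<otimes>\<^bsub>C\<^esub> Id C ?J = Id C ?IJ \<otimes>\<^bsub>C\<^esub> lam U ?J"
        using U.lam_rho[OF IJ J] by simp
      also have "\<dots> = Id C ?I \<otimes>\<^bsub>C\<^esub> (Id C ?J \<otimes>\<^bsub>C\<^esub> lam U ?J)"
        unfolding U.tensa_id[OF I J, symmetric]
        by (rule U.tensa_assoc_hom[OF U.id_hom[OF I] U.id_hom[OF J] U.lam_hom[OF J]])
      also have "(Id C ?I \<otimes>\<^bsub>C\<^esub> lam V ?J) \<cdot>\<^bsub>C\<^esub> \<dots> = Id C ?I \<otimes>\<^bsub>C\<^esub> (lam V ?J \<cdot>\<^bsub>C\<^esub> (Id C ?J \<otimes>\<^bsub>C\<^esub> lam U ?J))"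
        by (rule U.whisker_left[OF V.lam_hom[OF J] U.tensa_hom[OF U.id_hom[OF J] U.lam_hom[OF J]] I, symmetric])
      also have "lam V ?J \<cdot>\<^bsub>C\<^esub> (Id C ?J \<otimes>\<^bsub>C\<^esub> lam U ?J) = lam U ?J \<cdot>\<^bsub>C\<^esub> lam V ?IJ"
        by (rule V.lam_nat[OF U.lam_hom[OF J]])
      also have "Id C ?I \<otimes>\<^bsub>C\<^esub> \<dots> = (Id C ?I \<otimes>\<^bsub>C\<^esub> lam U ?J) \<cdot>\<^bsub>C\<^esub> (Id C ?I \<otimes>\<^bsub>C\<^esub> lam V ?IJ)"
        by (rule U.whisker_left[OF U.lam_hom[OF J] V.lam_hom[OF IJ] I])
      finally show ?thesis using A by (simp add: uW)
    qed
  qed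
qed

lemma unit_arr_comp:
  assumes "lr_unit C U" "lr_unit C V" "lr_unit C W" "unit_arr C V W q" "unit_arr C U V p"
  shows "unit_arr C U W (q \<cdot>\<^bsub>C\<^esub> p)"
proof -
  interpret U: lr_unit C U by fact
  interpret V: lr_unit C V by fact
  interpret W: lr_unit C W by fact
  have p: "p \<in> hom C (uobj U) (uobj V)" and q: "q \<in> hom C (uobj V) (uobj W)"
    using assms by (auto simp: unit_arr_def)
  show ?thesis unfolding unit_arr_def
  proof (intro conjI ballI)
    show "q \<cdot>\<^bsub>C\<^esub> p \<in> hom C (uobj U) (uobj W)" using U.comp_hom[OF q p] .
    fix X assume X: "X \<in> Obj C"
    show "lam W X \<cdot>\<^bsub>C\<^esub> ((q \<cdot>\<^bsub>C\<^esub> p) \<otimes>\<^bsub>C\<^esub> Id C X) = lam U X"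
      unfolding U.whisker_right[OF q p X] 
      using U.comp_assoc[OF W.lam_hom[OF X] U.tensa_hom[OF q U.id_hom[OF X]] U.tensa_hom[OF p U.id_hom[OF X]]]
        assms(4,5) X by (simp add: unit_arr_def)
    show "rho W X \<cdot>\<^bsub>C\<^esub> (Id C X \<otimes>\<^bsub>C\<^esub> (q \<cdot>\<^bsub>C\<^esub> p)) = rho U X"
      unfolding U.whisker_left[OF q p X] 
      using U.comp_assoc[OF W.rho_hom[OF X] U.tensa_hom[OF U.id_hom[OF X] q] U.tensa_hom[OF U.id_hom[OF X] p]]
        assms(4,5) X by (simp add: unit_arr_def)
  qed
qed

lemma unit_arr_id:
  assumes "lr_unit C U" shows "unit_arr C U U (Id C (uobj U))"
proof -
  interpret U: lr_unit C U by fact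
  show ?thesis unfolding unit_arr_def
    using U.id_hom U.uobj_obj U.tensa_id U.id_right[OF U.lam_hom] U.id_right[OF U.rho_hom] by auto
qed

lemma unit_arr_tens:
  assumes "lr_unit C U" "lr_unit C V" "lr_unit C U'" "lr_unit C V'"
    and p: "unit_arr C U V p" and p': "unit_arr C U' V' p'"
  shows "unit_arr C (unit_tens C U U') (unit_tens C V V') (p \<otimes>\<^bsub>C\<^esub> p')"
proof -
  interpret U: lr_unit C U by fact
  interpret V: lr_unit C V by fact
  interpret U': lr_unit C U' by fact
  interpret V': lr_unit C V' by fact
  have hp: "p \<in> hom C (uobj U) (uobj V)" and hp': "p' \<in> hom C (uobj U') (uobj V')"
    using assms by (auto simp: unit_arr_def)
  show ?thesis unfolding unit_arr_def
  proof (intro conjI ballI)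
    show "p \<otimes>\<^bsub>C\<^esub> p' \<in> hom C (uobj (unit_tens C U U')) (uobj (unit_tens C V V'))"
      using U.tensa_hom[OF hp hp'] by (simp add: unit_tens_def)
    fix X assume X: "X \<in> Obj C"
    have 1: "(Id C (uobj V) \<otimes>\<^bsub>C\<^esub> lam V' X) \<cdot>\<^bsub>C\<^esub> (p \<otimes>\<^bsub>C\<^esub> (p' \<otimes>\<^bsub>C\<^esub> Id C X)) = p \<otimes>\<^bsub>C\<^esub> lam U' X"
      using U.tensa_comp[OF U.id_hom[OF V.uobj_obj] hp V'.lam_hom[OF X] U.tensa_hom[OF hp' U.id_hom[OF X]]]
        U.id_left[OF hp] p' X by (simp add: unit_arr_def)
    have "lam (unit_tens C V V') X \<cdot>\<^bsub>C\<^esub> ((p \<otimes>\<^bsub>C\<^esub> p') \<otimes>\<^bsub>C\<^esub> Id C X)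
      = lam V X \<cdot>\<^bsub>C\<^esub> ((Id C (uobj V) \<otimes>\<^bsub>C\<^esub> lam V' X) \<cdot>\<^bsub>C\<^esub> (p \<otimes>\<^bsub>C\<^esub> (p' \<otimes>\<^bsub>C\<^esub> Id C X)))"
      using X U.tensa_assoc_hom[OF hp hp' U.id_hom[OF X]]
        U.comp_assoc[OF V.lam_hom[OF X] U.tensa_hom[OF U.id_hom[OF V.uobj_obj] V'.lam_hom[OF X]]
          U.tensa_hom[OF hp U.tensa_hom[OF hp' U.id_hom[OF X]]]]
      by (simp add: unit_tens_def)
    also have "\<dots> = lam V X \<cdot>\<^bsub>C\<^esub> ((p \<otimes>\<^bsub>C\<^esub> Id C X) \<cdot>\<^bsub>C\<^esub> (Id C (uobj U) \<otimes>\<^bsub>C\<^esub> lam U' X))"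
      unfolding 1 U.interchange1[OF hp U'.lam_hom[OF X]] ..
    also have "\<dots> = lam (unit_tens C U U') X"
      using U.comp_assoc[OF V.lam_hom[OF X] U.tensa_hom[OF hp U.id_hom[OF X]] U.tensa_hom[OF U.id_hom[OF U.uobj_obj] U'.lam_hom[OF X]]]
        p X by (simp add: unit_tens_def unit_arr_def)
    finally show "lam (unit_tens C V V') X \<cdot>\<^bsub>C\<^esub> ((p \<otimes>\<^bsub>C\<^esub> p') \<otimes>\<^bsub>C\<^esub> Id C X) = lam (unit_tens C U U') X" .
    have 2: "(rho V X \<otimes>\<^bsub>C\<^esub> Id C (uobj V')) \<cdot>\<^bsub>C\<^esub> ((Id C X \<otimes>\<^bsub>C\<^esub> p) \<otimes>\<^bsub>C\<^esub> p') = rho U X \<otimes>\<^bsub>C\<^esub> p'"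
      using U.tensa_comp[OF V.rho_hom[OF X] U.tensa_hom[OF U.id_hom[OF X] hp] U.id_hom[OF V'.uobj_obj] hp']
        U.id_left[OF hp'] p X by (simp add: unit_arr_def)
    have "rho (unit_tens C V V') X \<cdot>\<^bsub>C\<^esub> (Id C X \<otimes>\<^bsub>C\<^esub> (p \<otimes>\<^bsub>C\<^esub> p'))
      = rho V' X \<cdot>\<^bsub>C\<^esub> ((rho V X \<otimes>\<^bsub>C\<^esub> Id C (uobj V')) \<cdot>\<^bsub>C\<^esub> ((Id C X \<otimes>\<^bsub>C\<^esub> p) \<otimes>\<^bsub>C\<^esub> p'))"
      using X U.tensa_assoc_hom[OF U.id_hom[OF X] hp hp']
        U.comp_assoc[OF V'.rho_hom[OF X] U.tensa_hom[OF V.rho_hom[OF X] U.id_hom[OF V'.uobj_obj]]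
          U.tensa_hom[OF U.tensa_hom[OF U.id_hom[OF X] hp] hp']]
      by (simp add: unit_tens_def)
    also have "\<dots> = rho V' X \<cdot>\<^bsub>C\<^esub> ((Id C X \<otimes>\<^bsub>C\<^esub> p') \<cdot>\<^bsub>C\<^esub> (rho U X \<otimes>\<^bsub>C\<^esub> Id C (uobj U')))"
      unfolding 2 U.interchange2[OF U.rho_hom[OF X] hp'] ..
    also have "\<dots> = rho (unit_tens C U U') X"
      using U.comp_assoc[OF V'.rho_hom[OF X] U.tensa_hom[OF U.id_hom[OF X] hp'] U.tensa_hom[OF U.rho_hom[OF X] U.id_hom[OF U'.uobj_obj]]]
        p' X by (simp add: unit_tens_def unit_arr_def)
    finally show "rho (unit_tens C V V') X \<cdot>\<^bsub>C\<^esub> (Id C X \<otimes>\<^bsub>C\<^esub> (p \<otimes>\<^bsub>C\<^esub> p')) = rho (unit_tens C U U') X" .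
  qed
qed

lemma unit_tens_assoc:
  assumes "lr_unit C U" "lr_unit C V" "lr_unit C W"
  shows "unit_tens C (unit_tens C U V) W = unit_tens C U (unit_tens C V W)"
proof -
  interpret U: lr_unit C U by fact
  interpret V: lr_unit C V by fact
  interpret W: lr_unit C W by fact
  note o = U.uobj_obj V.uobj_obj W.uobj_obj
  have l: "(lam U X \<cdot>\<^bsub>C\<^esub> (Id C (uobj U) \<otimes>\<^bsub>C\<^esub> lam V X)) \<cdot>\<^bsub>C\<^esub> (Id C (uobj U \<odot>\<^bsub>C\<^esub> uobj V) \<otimes>\<^bsub>C\<^esub> lam W X)
     = lam U X \<cdot>\<^bsub>C\<^esub> (Id C (uobj U) \<otimes>\<^bsub>C\<^esub> (lam V X \<cdot>\<^bsub>C\<^esub> (Id C (uobj V) \<otimes>\<^bsub>C\<^esub> lam W X)))"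
    if X: "X \<in> Obj C" for X
  proof -
    have Jl: "Id C (uobj V) \<otimes>\<^bsub>C\<^esub> lam W X \<in> hom C (uobj V \<odot>\<^bsub>C\<^esub> (uobj W \<odot>\<^bsub>C\<^esub> X)) (uobj V \<odot>\<^bsub>C\<^esub> X)"
      by (intro U.tensa_hom U.id_hom W.lam_hom o X)
    have "Id C (uobj U \<odot>\<^bsub>C\<^esub> uobj V) \<otimes>\<^bsub>C\<^esub> lam W X = Id C (uobj U) \<otimes>\<^bsub>C\<^esub> (Id C (uobj V) \<otimes>\<^bsub>C\<^esub> lam W X)"
      unfolding U.tensa_id[OF o(1,2), symmetric]
      by (rule U.tensa_assoc_hom[OF U.id_hom[OF o(1)] U.id_hom[OF o(2)] W.lam_hom[OF X]])
    then show ?thesis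
      using U.whisker_left[OF V.lam_hom[OF X] Jl o(1)]
        U.comp_assoc[OF U.lam_hom[OF X] U.tensa_hom[OF U.id_hom[OF o(1)] V.lam_hom[OF X]] U.tensa_hom[OF U.id_hom[OF o(1)] Jl]]
      by simp
  qed
  have r: "rho W X \<cdot>\<^bsub>C\<^esub> ((rho V X \<cdot>\<^bsub>C\<^esub> (rho U X \<otimes>\<^bsub>C\<^esub> Id C (uobj V))) \<otimes>\<^bsub>C\<^esub> Id C (uobj W))
     = (rho W X \<cdot>\<^bsub>C\<^esub> (rho V X \<otimes>\<^bsub>C\<^esub> Id C (uobj W))) \<cdot>\<^bsub>C\<^esub> (rho U X \<otimes>\<^bsub>C\<^esub> Id C (uobj V \<odot>\<^bsub>C\<^esub> uobj W))"
    if X: "X \<in> Obj C" for X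
  proof -
    have Jl: "rho U X \<otimes>\<^bsub>C\<^esub> Id C (uobj V) \<in> hom C ((X \<odot>\<^bsub>C\<^esub> uobj U) \<odot>\<^bsub>C\<^esub> uobj V) (X \<odot>\<^bsub>C\<^esub> uobj V)"
      by (intro U.tensa_hom U.id_hom U.rho_hom o X)
    have "rho U X \<otimes>\<^bsub>C\<^esub> Id C (uobj V \<odot>\<^bsub>C\<^esub> uobj W) = (rho U X \<otimes>\<^bsub>C\<^esub> Id C (uobj V)) \<otimes>\<^bsub>C\<^esub> Id C (uobj W)"
      unfolding U.tensa_id[OF o(2,3), symmetric]
      by (rule U.tensa_assoc_hom[OF U.rho_hom[OF X] U.id_hom[OF o(2)] U.id_hom[OF o(3)], symmetric])
    then show ?thesis
      using U.whisker_right[OF V.rho_hom[OF X] Jl o(3)]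
        U.comp_assoc[OF W.rho_hom[OF X] U.tensa_hom[OF V.rho_hom[OF X] U.id_hom[OF o(3)]] U.tensa_hom[OF Jl U.id_hom[OF o(3)]]]
      by simp
  qed
  show ?thesis
    using l r U.tenso_assoc[OF o] by (auto simp: unit_tens_def restrict_def fun_eq_iff)
qed

lemma units_hom:
  "f \<in> hom (units C) U V \<longleftrightarrow> (\<exists>p. f = (U, p, V) \<and> lr_unit C U \<and> lr_unit C V \<and> unit_arr C U V p)"
  by (auto simp: hom_def units_def)

lemma units_semi_monoidal:
  assumes "semi_monoidal_category C"
  shows "semi_monoidal_category (units C)"
proof -
  interpret semi_monoidal_category C by fact
  have hD: "p \<in> hom C (uobj U) (uobj V)" if "unit_arr C U V p" for U V p
    using that by (simp add: unit_arr_def)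
  show ?thesis
  proof unfold_locales
    fix U V U' V' f g
    show "f \<in> Arr (units C) \<Longrightarrow> Dom (units C) f \<in> Obj (units C)"
      "f \<in> Arr (units C) \<Longrightarrow> Cod (units C) f \<in> Obj (units C)"
      by (auto simp: units_def)
    show "U \<in> Obj (units C) \<Longrightarrow> Id (units C) U \<in> hom (units C) U U"
      by (simp add: units_hom unit_arr_id) (simp add: units_def unit_arr_id)
    show "\<lbrakk>U \<in> Obj (units C); V \<in> Obj (units C)\<rbrakk> \<Longrightarrow> U \<odot>\<^bsub>units C\<^esub> V \<in> Obj (units C)"
      by (auto simp: units_def unit_tens_lr_unit)
    show "\<lbrakk>U \<in> Obj (units C); V \<in> Obj (units C)\<rbrakk>
      \<Longrightarrow> Id (units C) U \<otimes>\<^bsub>units C\<^esub> Id (units C) V = Id (units C) (U \<odot>\<^bsub>units C\<^esub> V)"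
      by (auto simp: units_def unit_tens_def lr_unit.uobj_obj tensa_id)
  next
    fix g f U V W assume "g \<in> hom (units C) V W" "f \<in> hom (units C) U V"
    then show "g \<cdot>\<^bsub>units C\<^esub> f \<in> hom (units C) U W"
      by (auto simp: units_hom) (auto simp: units_def intro: unit_arr_comp)
  next
    fix f U V assume "f \<in> hom (units C) U V"
    then show "Id (units C) V \<cdot>\<^bsub>units C\<^esub> f = f" "f \<cdot>\<^bsub>units C\<^esub> Id (units C) U = f"
      by (auto simp: units_hom) (auto simp: units_def unit_arr_def id_left id_right)
  next
    fix h g f U V W X assume "h \<in> hom (units C) V W" "g \<in> hom (units C) U V" "f \<in> hom (units C) X U"
    then show "(h \<cdot>\<^bsub>units C\<^esub> g) \<cdot>\<^bsub>units C\<^esub> f = h \<cdot>\<^bsub>units C\<^esub> (g \<cdot>\<^bsub>units C\<^esub> f)"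
      by (auto simp: units_hom) (auto simp: units_def intro!: comp_assoc dest: hD)
  next
    fix f U V g U' V' assume "f \<in> hom (units C) U V" "g \<in> hom (units C) U' V'"
    then show "f \<otimes>\<^bsub>units C\<^esub> g \<in> hom (units C) (U \<odot>\<^bsub>units C\<^esub> U') (V \<odot>\<^bsub>units C\<^esub> V')"
      by (auto simp: units_hom) (auto simp: units_def intro: unit_tens_lr_unit unit_arr_tens)
  next
    fix g V W f U g' V' W' f' U'
    assume "g \<in> hom (units C) V W" "f \<in> hom (units C) U V" "g' \<in> hom (units C) V' W'" "f' \<in> hom (units C) U' V'"
    then show "(g \<cdot>\<^bsub>units C\<^esub> f) \<otimes>\<^bsub>units C\<^esub> (g' \<cdot>\<^bsub>units C\<^esub> f')
       = (g \<otimes>\<^bsub>units C\<^esub> g') \<cdot>\<^bsub>units C\<^esub> (f \<otimes>\<^bsub>units C\<^esub> f')"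
      by (auto simp: units_hom) (auto simp: units_def intro!: tensa_comp dest: hD)
  next
    fix U V W assume "U \<in> Obj (units C)" "V \<in> Obj (units C)" "W \<in> Obj (units C)"
    then show "(U \<odot>\<^bsub>units C\<^esub> V) \<odot>\<^bsub>units C\<^esub> W = U \<odot>\<^bsub>units C\<^esub> (V \<odot>\<^bsub>units C\<^esub> W)"
      by (auto simp: units_def unit_tens_assoc)
  next
    fix f g h assume "f \<in> Arr (units C)" "g \<in> Arr (units C)" "h \<in> Arr (units C)"
    then show "(f \<otimes>\<^bsub>units C\<^esub> g) \<otimes>\<^bsub>units C\<^esub> h = f \<otimes>\<^bsub>units C\<^esub> (g \<otimes>\<^bsub>units C\<^esub> h)"
      by (auto simp: units_def unit_tens_assoc intro!: tensa_assoc_hom dest: hD)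
  qed
qed

lemma units_contractible:
  assumes "lr_unit C U" "lr_unit C V"
  shows "\<exists>!f. f \<in> hom (units C) U V"
proof -
  interpret U: lr_unit C U by fact
  interpret V: lr_unit C V by fact
  let ?I = "uobj U" and ?J = "uobj V"
  have I: "?I \<in> Obj C" and J: "?J \<in> Obj C" using U.uobj_obj V.uobj_obj by auto
  obtain s where s: "s \<in> hom C ?I (?I \<odot>\<^bsub>C\<^esub> ?J)" "s \<cdot>\<^bsub>C\<^esub> rho V ?I = Id C (?I \<odot>\<^bsub>C\<^esub> ?J)"
    "rho V ?I \<cdot>\<^bsub>C\<^esub> s = Id C ?I"
    using V.rho_iso[OF I] unfolding iso_arr_def by blast
  let ?p = "lam U ?J \<cdot>\<^bsub>C\<^esub> s"
  have p: "?p \<in> hom C ?I ?J" using U.comp_hom[OF U.lam_hom[OF J] s(1)] .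
  have prho: "?p \<cdot>\<^bsub>C\<^esub> rho V ?I = lam U ?J"
    using U.comp_assoc[OF U.lam_hom[OF J] s(1) V.rho_hom[OF I]] s(2) U.id_right[OF U.lam_hom[OF J]] by simp
  have l: "lam V X \<cdot>\<^bsub>C\<^esub> (?p \<otimes>\<^bsub>C\<^esub> Id C X) = lam U X" if X: "X \<in> Obj C" for X
  proof (rule U.iso_epi[OF U.iso_tens[OF V.rho_iso[OF I] U.iso_id[OF X]]])
    show "lam U X \<in> hom C (?I \<odot>\<^bsub>C\<^esub> X) X" by (rule U.lam_hom[OF X])
    have pX: "?p \<otimes>\<^bsub>C\<^esub> Id C X \<in> hom C (?I \<odot>\<^bsub>C\<^esub> X) (?J \<odot>\<^bsub>C\<^esub> X)" by (intro U.tensa_hom p U.id_hom X)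
    show "lam V X \<cdot>\<^bsub>C\<^esub> (?p \<otimes>\<^bsub>C\<^esub> Id C X) \<in> hom C (?I \<odot>\<^bsub>C\<^esub> X) X" by (rule U.comp_hom[OF V.lam_hom[OF X] pX])
    have "(lam V X \<cdot>\<^bsub>C\<^esub> (?p \<otimes>\<^bsub>C\<^esub> Id C X)) \<cdot>\<^bsub>C\<^esub> (rho V ?I \<otimes>\<^bsub>C\<^esub> Id C X) = lam V X \<cdot>\<^bsub>C\<^esub> lam U (?J \<odot>\<^bsub>C\<^esub> X)"
      using U.comp_assoc[OF V.lam_hom[OF X] pX U.tensa_hom[OF V.rho_hom[OF I] U.id_hom[OF X]]]
        U.whisker_right[OF p V.rho_hom[OF I] X] prho U.lam_tens[OF J X] by simp
    also have "\<dots> = lam U X \<cdot>\<^bsub>C\<^esub> (Id C ?I \<otimes>\<^bsub>C\<^esub> lam V X)"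
      using U.lam_nat[OF V.lam_hom[OF X]] by simp
    also have "Id C ?I \<otimes>\<^bsub>C\<^esub> lam V X = rho V ?I \<otimes>\<^bsub>C\<^esub> Id C X" by (rule V.lam_rho[OF I X])
    finally show "(lam V X \<cdot>\<^bsub>C\<^esub> (?p \<otimes>\<^bsub>C\<^esub> Id C X)) \<cdot>\<^bsub>C\<^esub> (rho V ?I \<otimes>\<^bsub>C\<^esub> Id C X)
      = lam U X \<cdot>\<^bsub>C\<^esub> (rho V ?I \<otimes>\<^bsub>C\<^esub> Id C X)" .
  qed
  have r: "rho V X \<cdot>\<^bsub>C\<^esub> (Id C X \<otimes>\<^bsub>C\<^esub> ?p) = rho U X" if X: "X \<in> Obj C" for X
  proof (rule U.iso_epi[OF U.iso_tens[OF U.iso_id[OF X] V.rho_iso[OF I]]])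
    show "rho U X \<in> hom C (X \<odot>\<^bsub>C\<^esub> ?I) X" by (rule U.rho_hom[OF X])
    have pX: "Id C X \<otimes>\<^bsub>C\<^esub> ?p \<in> hom C (X \<odot>\<^bsub>C\<^esub> ?I) (X \<odot>\<^bsub>C\<^esub> ?J)" by (intro U.tensa_hom p U.id_hom X)
    show "rho V X \<cdot>\<^bsub>C\<^esub> (Id C X \<otimes>\<^bsub>C\<^esub> ?p) \<in> hom C (X \<odot>\<^bsub>C\<^esub> ?I) X" by (rule U.comp_hom[OF V.rho_hom[OF X] pX])
    have "(rho V X \<cdot>\<^bsub>C\<^esub> (Id C X \<otimes>\<^bsub>C\<^esub> ?p)) \<cdot>\<^bsub>C\<^esub> (Id C X \<otimes>\<^bsub>C\<^esub> rho V ?I) = rho V X \<cdot>\<^bsub>C\<^esub> (Id C X \<otimes>\<^bsub>C\<^esub> lam U ?J)"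
      using U.comp_assoc[OF V.rho_hom[OF X] pX U.tensa_hom[OF U.id_hom[OF X] V.rho_hom[OF I]]]
        U.whisker_left[OF p V.rho_hom[OF I] X] prho by simp
    also have "\<dots> = rho U X \<cdot>\<^bsub>C\<^esub> rho V (X \<odot>\<^bsub>C\<^esub> ?I)"
      using V.rho_nat[OF U.rho_hom[OF X]] U.lam_rho[OF X J] by simp
    finally show "(rho V X \<cdot>\<^bsub>C\<^esub> (Id C X \<otimes>\<^bsub>C\<^esub> ?p)) \<cdot>\<^bsub>C\<^esub> (Id C X \<otimes>\<^bsub>C\<^esub> rho V ?I)
      = rho U X \<cdot>\<^bsub>C\<^esub> (Id C X \<otimes>\<^bsub>C\<^esub> rho V ?I)"
      using V.rho_tens[OF X I] by simp
  qed
  have "unit_arr C U V ?p" using p l r by (simp add: unit_arr_def)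
  moreover have "q = q'" if "unit_arr C U V q" "unit_arr C U V q'" for q q'
  proof -
    have q: "q \<in> hom C ?I ?J" and q': "q' \<in> hom C ?I ?J"
      using that by (auto simp: unit_arr_def)
    have qJ: "q \<otimes>\<^bsub>C\<^esub> Id C ?J = q' \<otimes>\<^bsub>C\<^esub> Id C ?J"
      by (rule U.iso_mono[OF V.lam_iso[OF J]])
        (use that J q q' in \<open>auto simp: unit_arr_def intro!: U.tensa_hom U.id_hom\<close>)
    show ?thesis
      by (rule U.iso_epi[OF V.rho_iso[OF I] q q']) (use V.rho_nat[OF q] V.rho_nat[OF q'] qJ in simp)
  qed
  ultimately show ?thesis
    using assms by (auto simp: units_hom)
qed

lemma forgetful_strong_mult_functor:
  assumes "semi_monoidal_category C"
  shows "strong_mult_functor (units C) C (forgetful C)"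
proof -
  interpret semi_monoidal_category C by fact
  interpret U: semi_monoidal_category "units C" by (rule units_semi_monoidal) fact
  have o: "on_obj (forgetful C) U = uobj U" if "U \<in> Obj (units C)" for U
    using that by (simp add: forgetful_def)
  have a: "on_arr (forgetful C) f = fst (snd f)" if "f \<in> hom (units C) U V" for f U V
    using U.hom_arr[OF that] by (simp add: forgetful_def split: prod.splits)
  have c: "cmp (forgetful C) (U, V) = Id C (uobj U \<odot>\<^bsub>C\<^esub> uobj V)"
    if "U \<in> Obj (units C)" "V \<in> Obj (units C)" for U V
    using that by (simp add: forgetful_def)
  have t: "uobj (U \<odot>\<^bsub>units C\<^esub> V) = uobj U \<odot>\<^bsub>C\<^esub> uobj V" for U V
    by (simp add: units_def unit_tens_def)
  have i: "fst (snd (Id (units C) U)) = Id C (uobj U)" for U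
    by (simp add: units_def)
  have m: "fst (snd (g \<cdot>\<^bsub>units C\<^esub> f)) = fst (snd g) \<cdot>\<^bsub>C\<^esub> fst (snd f)"
    and n: "fst (snd (g \<otimes>\<^bsub>units C\<^esub> f)) = fst (snd g) \<otimes>\<^bsub>C\<^esub> fst (snd f)" for f g
    by (simp_all add: units_def split: prod.splits)
  have u: "uobj U \<in> Obj C" if "U \<in> Obj (units C)" for U
    using that by (simp add: units_def lr_unit.uobj_obj)
  have h: "fst (snd f) \<in> hom C (uobj U) (uobj V)" if "f \<in> hom (units C) U V" for f U V
    using that by (auto simp: units_hom unit_arr_def)
  show ?thesis
  proof unfold_locales
    show "on_obj (forgetful C) \<in> extensional (Obj (units C))"
      "on_arr (forgetful C) \<in> extensional (Arr (units C))"
      "cmp (forgetful C) \<in> extensional (Obj (units C) \<times> Obj (units C))"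
      by (auto simp: forgetful_def)
  next
    fix U V f
    show "U \<in> Obj (units C) \<Longrightarrow> on_obj (forgetful C) U \<in> Obj C" by (simp add: o u)
    show "U \<in> Obj (units C) \<Longrightarrow> on_arr (forgetful C) (Id (units C) U) = Id C (on_obj (forgetful C) U)"
      using a[OF U.id_hom] by (simp add: i o)
    assume "f \<in> hom (units C) U V"
    then show "on_arr (forgetful C) f \<in> hom C (on_obj (forgetful C) U) (on_obj (forgetful C) V)"
      using U.hom_objD by (metis a h o)
  next
    fix g V W f U assume "g \<in> hom (units C) V W" "f \<in> hom (units C) U V"
    then show "on_arr (forgetful C) (g \<cdot>\<^bsub>units C\<^esub> f) = on_arr (forgetful C) g \<cdot>\<^bsub>C\<^esub> on_arr (forgetful C) f"
      by (metis a m U.comp_hom)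
  next
    fix U V assume UV: "U \<in> Obj (units C)" "V \<in> Obj (units C)"
    then show "iso_arr C (on_obj (forgetful C) U \<odot>\<^bsub>C\<^esub> on_obj (forgetful C) V)
       (on_obj (forgetful C) (U \<odot>\<^bsub>units C\<^esub> V)) (cmp (forgetful C) (U, V))"
      by (simp add: o c t U.tenso_obj u tenso_obj iso_id)
    fix W assume W: "W \<in> Obj (units C)"
    show "cmp (forgetful C) (U \<odot>\<^bsub>units C\<^esub> V, W) \<cdot>\<^bsub>C\<^esub> (cmp (forgetful C) (U, V) \<otimes>\<^bsub>C\<^esub> Id C (on_obj (forgetful C) W))
      = cmp (forgetful C) (U, V \<odot>\<^bsub>units C\<^esub> W) \<cdot>\<^bsub>C\<^esub> (Id C (on_obj (forgetful C) U) \<otimes>\<^bsub>C\<^esub> cmp (forgetful C) (V, W))"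
      using UV W by (simp add: o c t U.tenso_obj u tenso_obj tensa_id tenso_assoc)
  next
    fix f U U' g V V' assume f: "f \<in> hom (units C) U U'" and g: "g \<in> hom (units C) V V'"
    have ob: "U \<in> Obj (units C)" "U' \<in> Obj (units C)" "V \<in> Obj (units C)" "V' \<in> Obj (units C)"
      using U.hom_objD[OF f] U.hom_objD[OF g] by auto
    show "cmp (forgetful C) (U', V') \<cdot>\<^bsub>C\<^esub> (on_arr (forgetful C) f \<otimes>\<^bsub>C\<^esub> on_arr (forgetful C) g)
      = on_arr (forgetful C) (f \<otimes>\<^bsub>units C\<^esub> g) \<cdot>\<^bsub>C\<^esub> cmp (forgetful C) (U, V)"
      using tensa_hom[OF h[OF f] h[OF g]] ob
      by (simp add: a[OF f] a[OF g] a[OF U.tensa_hom[OF f g]] n c id_left id_right)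
  qed
qed


section \<open>Unit compatibilities and lifts\<close>

definition unit_compatibility :: "('o, 'a) smcat \<Rightarrow> ('p, 'b) smcat \<Rightarrow> ('o, 'a, 'p, 'b) mult_fun \<Rightarrow>
    ('o, 'a) unit_str \<Rightarrow> ('p, 'b) unit_str \<Rightarrow> 'b \<Rightarrow> bool" where
  "unit_compatibility C D F I J p \<longleftrightarrow>
     iso_arr D (uobj J) (on_obj F (uobj I)) p \<and>
     p \<cdot>\<^bsub>D\<^esub> saavedra_arr J
       = on_arr F (saavedra_arr I) \<cdot>\<^bsub>D\<^esub> (cmp F (uobj I, uobj I) \<cdot>\<^bsub>D\<^esub> (p \<otimes>\<^bsub>D\<^esub> p))"

definition compatibility_families :: "('o, 'a) smcat \<Rightarrow> ('p, 'b) smcat \<Rightarrow> ('o, 'a, 'p, 'b) mult_fun \<Rightarrow>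
    (('o, 'a) unit_str \<times> ('p, 'b) unit_str \<Rightarrow> 'b) set" where
  "compatibility_families C D F =
     (\<Pi>\<^sub>E (I, J) \<in> Obj (units C) \<times> Obj (units D). {p. unit_compatibility C D F I J p})"

definition lifts :: "('o, 'a) smcat \<Rightarrow> ('p, 'b) smcat \<Rightarrow> ('o, 'a, 'p, 'b) mult_fun \<Rightarrow>
    (('o, 'a) unit_str, ('o, 'a) unit_str \<times> 'a \<times> ('o, 'a) unit_str,
     ('p, 'b) unit_str, ('p, 'b) unit_str \<times> 'b \<times> ('p, 'b) unit_str) mult_fun set" where
  "lifts C D F =
     {L. strong_mult_functor (units C) (units D) L \<and>
         mult_fun_comp (units C) D (forgetful D) L = mult_fun_comp (units C) D F (forgetful C)}"

definition lift_family :: "('o, 'a) smcat \<Rightarrow> ('p, 'b) smcat \<Rightarrow>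
    (('o, 'a) unit_str, ('o, 'a) unit_str \<times> 'a \<times> ('o, 'a) unit_str,
     ('p, 'b) unit_str, ('p, 'b) unit_str \<times> 'b \<times> ('p, 'b) unit_str) mult_fun \<Rightarrow>
    ('o, 'a) unit_str \<times> ('p, 'b) unit_str \<Rightarrow> 'b" where
  "lift_family C D L =
     (\<lambda>(I, J) \<in> Obj (units C) \<times> Obj (units D).
        on_arr (forgetful D) (THE f. f \<in> hom (units D) J (on_obj L I)))"

end

theory Submission
  imports Defs
begin

text \<open>
  Transporting a unit \<open>J\<close> along one unit compatibility makes \<open>F(I)\<close> a unit whose Saavedra arrow is
  \<open>F(I) F(I) \<rightarrow> F(I I) \<rightarrow> F(I)\<close>; applying \<open>F\<close> to arrows of units then gives such a structure on the
  image of every unit, and a unit is determined by its object and its Saavedra arrow. Unit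
  compatibilities \<open>J \<rightarrow> F(I)\<close> are exactly the arrows of units into this structure, so there is
  exactly one for each \<open>I\<close> and \<open>J\<close>. Any lift must send \<open>I\<close> to this structure, and these structures
  do form a lift. Hence both sets of the bijection are singletons.
\<close>

section \<open>Arrows of units, Saavedra arrows and transport of unit structures\<close>

lemma unit_arr_ex1:
  assumes "lr_unit C U" "lr_unit C V"
  shows "\<exists>!p. unit_arr C U V p"
  using units_contractible[OF assms] assms unfolding units_hom by auto

lemma unit_arr_unique:
  assumes "lr_unit C U" "lr_unit C V" "unit_arr C U V p" "unit_arr C U V q"
  shows "p = q"
  using unit_arr_ex1[OF assms(1,2)] assms(3,4) by blast

lemma unit_arr_hom: "unit_arr C U V p \<Longrightarrow> p \<in> hom C (uobj U) (uobj V)"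
  by (simp add: unit_arr_def)

text \<open>Contractibility supplies an arrow back, and both round trips are endomorphisms of a
  unit, of which the identity is the only one.\<close>

lemma unit_arr_iso:
  assumes U: "lr_unit C U" and V: "lr_unit C V" and p: "unit_arr C U V p"
  shows "iso_arr C (uobj U) (uobj V) p"
proof -
  obtain q where q: "unit_arr C V U q" using unit_arr_ex1[OF V U] by blast
  have "q \<cdot>\<^bsub>C\<^esub> p = Id C (uobj U)"
    by (rule unit_arr_unique[OF U U unit_arr_comp[OF U V U q p] unit_arr_id[OF U]])
  moreover have "p \<cdot>\<^bsub>C\<^esub> q = Id C (uobj V)"
    by (rule unit_arr_unique[OF V V unit_arr_comp[OF V U V p q] unit_arr_id[OF V]])
  ultimately show ?thesis
    using unit_arr_hom[OF p] unit_arr_hom[OF q] by (auto simp: iso_arr_def)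
qed

text \<open>
  Compatibility with a single left constraint suffices: it identifies \<open>p\<close> with the unique arrow of
  units \<open>U \<rightarrow> V\<close>.
\<close>

lemma unit_arrI_lam:
  assumes "lr_unit C U" "lr_unit C V" and p: "p \<in> hom C (uobj U) (uobj V)"
    and l: "lam V (uobj V) \<cdot>\<^bsub>C\<^esub> (p \<otimes>\<^bsub>C\<^esub> Id C (uobj V)) = lam U (uobj V)"
  shows "unit_arr C U V p"
proof -
  interpret U: lr_unit C U by fact
  interpret V: lr_unit C V by fact
  note J = V.uobj_obj
  obtain q where q: "unit_arr C U V q" using unit_arr_ex1[OF assms(1,2)] by blast
  note hq = unit_arr_hom[OF q]
  have "p \<otimes>\<^bsub>C\<^esub> Id C (uobj V) = q \<otimes>\<^bsub>C\<^esub> Id C (uobj V)"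
    by (rule U.iso_mono[OF V.lam_iso[OF J] U.tensa_hom[OF p U.id_hom[OF J]] U.tensa_hom[OF hq U.id_hom[OF J]]])
      (use l q J in \<open>simp add: unit_arr_def\<close>)
  \<comment> \<open>Tensoring on the right with \<open>uobj V\<close> is faithful, because
    \<open>rho V\<close> is a natural isomorphism from that functor to the identity: p and q agree
    after precomposition with \<open>rho V (uobj U)\<close>, which cancels.\<close>
  then have "p = q"
    using U.iso_epi[OF V.rho_iso[OF U.uobj_obj] p hq] V.rho_nat[OF p] V.rho_nat[OF hq] by simp
  with q show ?thesis by simp
qed

text \<open>Write p \<otimes> p as p \<otimes> I followed by J \<otimes> p. Naturality moves the
  second factor past the left constraint of V, and compatibility of p with left constraints absorbs
  the first.\<close>

lemma unit_arr_saavedra: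
  assumes "lr_unit C U" "lr_unit C V" and p: "unit_arr C U V p"
  shows "p \<cdot>\<^bsub>C\<^esub> saavedra_arr U = saavedra_arr V \<cdot>\<^bsub>C\<^esub> (p \<otimes>\<^bsub>C\<^esub> p)"
proof -
  interpret U: lr_unit C U by fact
  interpret V: lr_unit C V by fact
  note I = U.uobj_obj and J = V.uobj_obj
  note hp = unit_arr_hom[OF p]
  have "lam V (uobj V) \<cdot>\<^bsub>C\<^esub> (p \<otimes>\<^bsub>C\<^esub> p)
    = lam V (uobj V) \<cdot>\<^bsub>C\<^esub> ((Id C (uobj V) \<otimes>\<^bsub>C\<^esub> p) \<cdot>\<^bsub>C\<^esub> (p \<otimes>\<^bsub>C\<^esub> Id C (uobj U)))"
    by (simp add: U.interchange2[OF hp hp])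
  also have "\<dots> = (p \<cdot>\<^bsub>C\<^esub> lam V (uobj U)) \<cdot>\<^bsub>C\<^esub> (p \<otimes>\<^bsub>C\<^esub> Id C (uobj U))"
    using U.comp_assoc[OF V.lam_hom[OF J] U.tensa_hom[OF U.id_hom[OF J] hp] U.tensa_hom[OF hp U.id_hom[OF I]]]
      V.lam_nat[OF hp] by simp
  also have "\<dots> = p \<cdot>\<^bsub>C\<^esub> lam U (uobj U)"
    using U.comp_assoc[OF hp V.lam_hom[OF I] U.tensa_hom[OF hp U.id_hom[OF I]]] p I
    by (simp add: unit_arr_def)
  finally show ?thesis by (simp add: saavedra_arr_def)
qed

text \<open>Converse of \<open>unit_arr_saavedra\<close> for isomorphisms. The Saavedra equation is
  the left constraint condition at \<open>uobj V\<close> precomposed with I \<otimes> p; since p is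
  invertible this factor cancels, and \<open>unit_arrI_lam\<close> applies.\<close>

lemma unit_arrI_saavedra:
  assumes "lr_unit C U" "lr_unit C V" and p: "iso_arr C (uobj U) (uobj V) p"
    and eq: "p \<cdot>\<^bsub>C\<^esub> saavedra_arr U = saavedra_arr V \<cdot>\<^bsub>C\<^esub> (p \<otimes>\<^bsub>C\<^esub> p)"
  shows "unit_arr C U V p"
proof -
  interpret U: lr_unit C U by fact
  interpret V: lr_unit C V by fact
  note I = U.uobj_obj and J = V.uobj_obj
  note hp = U.iso_hom[OF p]
  note pJ = U.tensa_hom[OF hp U.id_hom[OF J]]
  have "lam V (uobj V) \<cdot>\<^bsub>C\<^esub> (p \<otimes>\<^bsub>C\<^esub> Id C (uobj V)) = lam U (uobj V)"
  proof (rule U.iso_epi[OF U.iso_tens[OF U.iso_id[OF I] p] U.comp_hom[OF V.lam_hom[OF J] pJ] U.lam_hom[OF J]])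
    have "(lam V (uobj V) \<cdot>\<^bsub>C\<^esub> (p \<otimes>\<^bsub>C\<^esub> Id C (uobj V))) \<cdot>\<^bsub>C\<^esub> (Id C (uobj U) \<otimes>\<^bsub>C\<^esub> p)
      = lam V (uobj V) \<cdot>\<^bsub>C\<^esub> (p \<otimes>\<^bsub>C\<^esub> p)"
      using U.comp_assoc[OF V.lam_hom[OF J] pJ U.tensa_hom[OF U.id_hom[OF I] hp]]
        U.interchange1[OF hp hp] by simp
    also have "\<dots> = lam U (uobj V) \<cdot>\<^bsub>C\<^esub> (Id C (uobj U) \<otimes>\<^bsub>C\<^esub> p)"
      using eq U.lam_nat[OF hp] by (simp add: saavedra_arr_def)
    finally show "(lam V (uobj V) \<cdot>\<^bsub>C\<^esub> (p \<otimes>\<^bsub>C\<^esub> Id C (uobj V))) \<cdot>\<^bsub>C\<^esub> (Id C (uobj U) \<otimes>\<^bsub>C\<^esub> p)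
      = lam U (uobj V) \<cdot>\<^bsub>C\<^esub> (Id C (uobj U) \<otimes>\<^bsub>C\<^esub> p)" .
  qed
  then show ?thesis by (rule unit_arrI_lam[OF assms(1,2) hp])
qed

text \<open>The identity of the common object satisfies the hypothesis of
  \<open>unit_arrI_lam\<close>, hence is an arrow of units from U to V. Its compatibility equations
  say that the constraints agree on objects, and extensionality settles the rest.\<close>

lemma lr_unit_eqI_saavedra:
  fixes C :: "('o, 'a) smcat"
  assumes "lr_unit C U" "lr_unit C V" "uobj U = uobj V" "saavedra_arr U = saavedra_arr V"
  shows "U = V"
proof -
  interpret U: lr_unit C U by fact
  interpret V: lr_unit C V by fact
  note K = V.uobj_obj
  have "lam V (uobj V) \<cdot>\<^bsub>C\<^esub> (Id C (uobj V) \<otimes>\<^bsub>C\<^esub> Id C (uobj V)) = lam U (uobj V)"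
    using assms(3,4) U.id_right[OF V.lam_hom[OF K]] U.tensa_id[OF K K] by (simp add: saavedra_arr_def)
  then have a: "unit_arr C U V (Id C (uobj V))"
    using unit_arrI_lam[OF assms(1,2)] assms(3) U.id_hom[OF K] by simp
  have "lam U X = lam V X" "rho U X = rho V X" if X: "X \<in> Obj C" for X
    using a X U.id_right[OF V.lam_hom[OF X]] U.id_right[OF V.rho_hom[OF X]] U.tensa_id[OF K X] U.tensa_id[OF X K]
    by (metis unit_arr_def)+
  then have "lam U = lam V" "rho U = rho V"
    using extensionalityI[OF U.lam_ext V.lam_ext] extensionalityI[OF U.rho_ext V.rho_ext] by blast+
  with assms(3) show ?thesis by (simp add: unit_str.equality)
qed

lemma lr_unit_transport:
  fixes C :: "('o, 'a) smcat"
  assumes "lr_unit C U" and p: "iso_arr C (uobj U) K p"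
  obtains V where "lr_unit C V" "uobj V = K" "unit_arr C U V p"
proof -
  interpret U: lr_unit C U by fact
  obtain q where hp: "p \<in> hom C (uobj U) K" and hq: "q \<in> hom C K (uobj U)"
    and qp: "q \<cdot>\<^bsub>C\<^esub> p = Id C (uobj U)" and pq: "p \<cdot>\<^bsub>C\<^esub> q = Id C K"
    using p by (auto simp: iso_arr_def)
  then have q: "iso_arr C K (uobj U) q" by (auto simp: iso_arr_def)
  note J = U.uobj_obj
  have K: "K \<in> Obj C" using U.hom_objD[OF hp] by simp
  \<comment> \<open>Precomposing the constraints of U with the inverse q is forced by the demand
    that p be an arrow of units.\<close>
  define V where "V = \<lparr>uobj = K,
      lam = (\<lambda>X \<in> Obj C. lam U X \<cdot>\<^bsub>C\<^esub> (q \<otimes>\<^bsub>C\<^esub> Id C X)),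
      rho = (\<lambda>X \<in> Obj C. rho U X \<cdot>\<^bsub>C\<^esub> (Id C X \<otimes>\<^bsub>C\<^esub> q))\<rparr>"
  have uV: "uobj V = K" by (simp add: V_def)
  have lV: "lam V X = lam U X \<cdot>\<^bsub>C\<^esub> (q \<otimes>\<^bsub>C\<^esub> Id C X)"
    and rV: "rho V X = rho U X \<cdot>\<^bsub>C\<^esub> (Id C X \<otimes>\<^bsub>C\<^esub> q)" if "X \<in> Obj C" for X
    using that by (simp_all add: V_def)
  have hqX: "q \<otimes>\<^bsub>C\<^esub> Id C X \<in> hom C (K \<odot>\<^bsub>C\<^esub> X) (uobj U \<odot>\<^bsub>C\<^esub> X)"
    and hXq: "Id C X \<otimes>\<^bsub>C\<^esub> q \<in> hom C (X \<odot>\<^bsub>C\<^esub> K) (X \<odot>\<^bsub>C\<^esub> uobj U)" if "X \<in> Obj C" for X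
    using that by (auto intro: U.tensa_hom U.id_hom hq)
  have lV_hom: "lam V X \<in> hom C (K \<odot>\<^bsub>C\<^esub> X) X" and rV_hom: "rho V X \<in> hom C (X \<odot>\<^bsub>C\<^esub> K) X"
    if X: "X \<in> Obj C" for X
    using U.comp_hom[OF U.lam_hom[OF X] hqX[OF X]] U.comp_hom[OF U.rho_hom[OF X] hXq[OF X]]
    by (simp_all add: lV rV X)
  have lam_p: "lam V X \<cdot>\<^bsub>C\<^esub> (p \<otimes>\<^bsub>C\<^esub> Id C X) = lam U X" if X: "X \<in> Obj C" for X
    using U.comp_assoc[OF U.lam_hom[OF X] hqX[OF X] U.tensa_hom[OF hp U.id_hom[OF X]]]
      U.whisker_right[OF hq hp X] U.id_right[OF U.lam_hom[OF X]] qp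
    by (simp add: lV X U.tensa_id J)
  have rho_p: "rho V X \<cdot>\<^bsub>C\<^esub> (Id C X \<otimes>\<^bsub>C\<^esub> p) = rho U X" if X: "X \<in> Obj C" for X
    using U.comp_assoc[OF U.rho_hom[OF X] hXq[OF X] U.tensa_hom[OF U.id_hom[OF X] hp]]
      U.whisker_left[OF hq hp X] U.id_right[OF U.rho_hom[OF X]] qp
    by (simp add: rV X U.tensa_id J)
  have "lr_unit C V"
  proof unfold_locales
    show "uobj V \<in> Obj C" by (simp add: uV K)
    show "lam V \<in> extensional (Obj C)" "rho V \<in> extensional (Obj C)" by (auto simp: V_def)
    show "iso_arr C (uobj V \<odot>\<^bsub>C\<^esub> X) X (lam V X)" "iso_arr C (X \<odot>\<^bsub>C\<^esub> uobj V) X (rho V X)"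
      if X: "X \<in> Obj C" for X
      unfolding uV lV[OF X] rV[OF X]
      by (intro U.iso_comp[OF U.lam_iso] U.iso_comp[OF U.rho_iso] U.iso_tens q U.iso_id X)+
    show "lam V Y \<cdot>\<^bsub>C\<^esub> (Id C (uobj V) \<otimes>\<^bsub>C\<^esub> f) = f \<cdot>\<^bsub>C\<^esub> lam V X" if f: "f \<in> hom C X Y" for f X Y
    proof -
      have X: "X \<in> Obj C" and Y: "Y \<in> Obj C" using U.hom_objD[OF f] by auto
      show ?thesis
        using U.comp_assoc[OF U.lam_hom[OF Y] hqX[OF Y] U.tensa_hom[OF U.id_hom[OF K] f]]
          U.comp_assoc[OF U.lam_hom[OF Y] U.tensa_hom[OF U.id_hom[OF J] f] hqX[OF X]]
          U.comp_assoc[OF f U.lam_hom[OF X] hqX[OF X]]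
          U.interchange1[OF hq f] U.interchange2[OF hq f] U.lam_nat[OF f]
        by (simp add: lV X Y uV)
    qed
    show "rho V Y \<cdot>\<^bsub>C\<^esub> (f \<otimes>\<^bsub>C\<^esub> Id C (uobj V)) = f \<cdot>\<^bsub>C\<^esub> rho V X" if f: "f \<in> hom C X Y" for f X Y
    proof -
      have X: "X \<in> Obj C" and Y: "Y \<in> Obj C" using U.hom_objD[OF f] by auto
      show ?thesis
        using U.comp_assoc[OF U.rho_hom[OF Y] hXq[OF Y] U.tensa_hom[OF f U.id_hom[OF K]]]
          U.comp_assoc[OF U.rho_hom[OF Y] U.tensa_hom[OF f U.id_hom[OF J]] hXq[OF X]]
          U.comp_assoc[OF f U.rho_hom[OF X] hXq[OF X]]
          U.interchange1[OF f hq] U.interchange2[OF f hq] U.rho_nat[OF f]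
        by (simp add: rV X Y uV)
    qed
    fix X Y assume X: "X \<in> Obj C" and Y: "Y \<in> Obj C"
    show "lam V (X \<odot>\<^bsub>C\<^esub> Y) = lam V X \<otimes>\<^bsub>C\<^esub> Id C Y"
      using U.whisker_right[OF U.lam_hom[OF X] hqX[OF X] Y] U.lam_tens[OF X Y]
        U.tensa_assoc_hom[OF hq U.id_hom[OF X] U.id_hom[OF Y]]
      by (simp add: lV X Y U.tenso_obj U.tensa_id)
    show "rho V (X \<odot>\<^bsub>C\<^esub> Y) = Id C X \<otimes>\<^bsub>C\<^esub> rho V Y"
      using U.whisker_left[OF U.rho_hom[OF Y] hXq[OF Y] X] U.rho_tens[OF X Y]
        U.tensa_assoc_hom[OF U.id_hom[OF X] U.id_hom[OF Y] hq]
      by (simp add: rV X Y U.tenso_obj U.tensa_id)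
    show "Id C X \<otimes>\<^bsub>C\<^esub> lam V Y = rho V X \<otimes>\<^bsub>C\<^esub> Id C Y"
      using U.whisker_left[OF U.lam_hom[OF Y] hqX[OF Y] X] U.whisker_right[OF U.rho_hom[OF X] hXq[OF X] Y]
        U.lam_rho[OF X Y] U.tensa_assoc_hom[OF U.id_hom[OF X] hq U.id_hom[OF Y]]
      by (simp add: lV rV X Y)
  next
    \<comment> \<open>Both sides are compared after precomposition with the isomorphism p \<otimes>
      p, where naturality reduces them to p composed with \<open>lam U\<close> and with
      \<open>rho U\<close> at \<open>uobj U\<close>.\<close>
    have "lam V K = rho V K"
    proof (rule U.iso_epi[OF U.iso_tens[OF p p] lV_hom[OF K] rV_hom[OF K]])
      have "lam V K \<cdot>\<^bsub>C\<^esub> (p \<otimes>\<^bsub>C\<^esub> p) = lam U K \<cdot>\<^bsub>C\<^esub> (Id C (uobj U) \<otimes>\<^bsub>C\<^esub> p)"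
        using U.comp_assoc[OF lV_hom[OF K] U.tensa_hom[OF hp U.id_hom[OF K]] U.tensa_hom[OF U.id_hom[OF J] hp]]
          U.interchange1[OF hp hp] lam_p[OF K] by simp
      also have "\<dots> = rho U K \<cdot>\<^bsub>C\<^esub> (p \<otimes>\<^bsub>C\<^esub> Id C (uobj U))"
        using U.lam_nat[OF hp] U.rho_nat[OF hp] U.lam_rho_unit by simp
      also have "\<dots> = rho V K \<cdot>\<^bsub>C\<^esub> (p \<otimes>\<^bsub>C\<^esub> p)"
        using U.comp_assoc[OF rV_hom[OF K] U.tensa_hom[OF U.id_hom[OF K] hp] U.tensa_hom[OF hp U.id_hom[OF J]]]
          U.interchange2[OF hp hp] rho_p[OF K] by simp
      finally show "lam V K \<cdot>\<^bsub>C\<^esub> (p \<otimes>\<^bsub>C\<^esub> p) = rho V K \<cdot>\<^bsub>C\<^esub> (p \<otimes>\<^bsub>C\<^esub> p)" .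
    qed
    then show "lam V (uobj V) = rho V (uobj V)" by (simp add: uV)
  qed
  moreover have "unit_arr C U V p"
    using hp lam_p rho_p by (simp add: unit_arr_def uV)
  ultimately show ?thesis using that uV by blast
qed

text \<open>The law \<open>lam_rho\<close> turns \<alpha> \<otimes> X into I \<otimes>
  \<open>lam U X\<close>, and X \<otimes> \<alpha> into \<open>rho U X\<close> \<otimes> I; these
  are the factors in the constraints of the product unit. By contractibility, \<alpha> is therefore
  the only arrow of units from the square of U to U.\<close>

lemma saavedra_arr_unit_arr:
  assumes "lr_unit C U"
  shows "unit_arr C (unit_tens C U U) U (saavedra_arr U)"
proof -
  interpret U: lr_unit C U by fact
  note I = U.uobj_obj
  show ?thesis unfolding unit_arr_def
  proof (intro conjI ballI)
    show "saavedra_arr U \<in> hom C (uobj (unit_tens C U U)) (uobj U)"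
      using U.lam_hom[OF I] by (simp add: saavedra_arr_def unit_tens_def)
    fix X assume X: "X \<in> Obj C"
    show "lam U X \<cdot>\<^bsub>C\<^esub> (saavedra_arr U \<otimes>\<^bsub>C\<^esub> Id C X) = lam (unit_tens C U U) X"
      using U.lam_rho[OF I X] U.lam_rho_unit X by (simp add: saavedra_arr_def unit_tens_def)
    show "rho U X \<cdot>\<^bsub>C\<^esub> (Id C X \<otimes>\<^bsub>C\<^esub> saavedra_arr U) = rho (unit_tens C U U) X"
      using U.lam_rho[OF X I] X by (simp add: saavedra_arr_def unit_tens_def)
  qed
qed

section \<open>Images of units under a strong multiplicative functor\<close>

locale strong_functor_semi_monoidal =
  strong_mult_functor C D F + C: semi_monoidal_category C + D: semi_monoidal_category D
  for C :: "('o, 'a) smcat" and D :: "('p, 'b) smcat" and F :: "('o, 'a, 'p, 'b) mult_fun"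
begin

text \<open>A relation, because existence of such a V is only obtained from a unit compatibility;
  uniqueness holds by \<open>lr_unit_eqI_saavedra\<close>.\<close>

definition image_unit :: "('o, 'a) unit_str \<Rightarrow> ('p, 'b) unit_str \<Rightarrow> bool" where
  "image_unit I V \<longleftrightarrow> lr_unit D V \<and> uobj V = on_obj F (uobj I) \<and>
     saavedra_arr V = on_arr F (saavedra_arr I) \<cdot>\<^bsub>D\<^esub> cmp F (uobj I, uobj I)"

lemma image_unitD:
  assumes "image_unit I V"
  shows "lr_unit D V" "uobj V = on_obj F (uobj I)"
    "saavedra_arr V = on_arr F (saavedra_arr I) \<cdot>\<^bsub>D\<^esub> cmp F (uobj I, uobj I)"
  using assms by (simp_all add: image_unit_def)

lemma image_unit_unique: "image_unit I V \<Longrightarrow> image_unit I W \<Longrightarrow> V = W"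
  by (auto simp: image_unit_def intro: lr_unit_eqI_saavedra)

lemma cmp_hom:
  "\<lbrakk>X \<in> Obj C; Y \<in> Obj C\<rbrakk>
    \<Longrightarrow> cmp F (X, Y) \<in> hom D (on_obj F X \<odot>\<^bsub>D\<^esub> on_obj F Y) (on_obj F (X \<odot>\<^bsub>C\<^esub> Y))"
  using cmp_iso by (simp add: iso_arr_def)

lemma map_iso:
  assumes "iso_arr C X Y f" shows "iso_arr D (on_obj F X) (on_obj F Y) (on_arr F f)"
proof -
  obtain g where f: "f \<in> hom C X Y" and g: "g \<in> hom C Y X" "g \<cdot>\<^bsub>C\<^esub> f = Id C X" "f \<cdot>\<^bsub>C\<^esub> g = Id C Y"
    using assms by (auto simp: iso_arr_def)
  have "on_arr F g \<cdot>\<^bsub>D\<^esub> on_arr F f = Id D (on_obj F X)" "on_arr F f \<cdot>\<^bsub>D\<^esub> on_arr F g = Id D (on_obj F Y)"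
    using map_comp[OF g(1) f] map_comp[OF f g(1)] g C.hom_objD[OF f] by (simp_all add: map_id)
  then show ?thesis using arr_map[OF f] arr_map[OF g(1)] by (auto simp: iso_arr_def)
qed

lemma map_saavedra_hom:
  assumes "lr_unit C I"
  shows "on_arr F (saavedra_arr I) \<in> hom D (on_obj F (uobj I \<odot>\<^bsub>C\<^esub> uobj I)) (on_obj F (uobj I))"
proof -
  interpret I: lr_unit C I by fact
  show ?thesis using arr_map[OF I.lam_hom[OF I.uobj_obj]] by (simp add: saavedra_arr_def)
qed

text \<open>With the Saavedra arrow of V inserted and reassociated, the compatibility equation is
  the equation of \<open>unit_arr_saavedra\<close> and \<open>unit_arrI_saavedra\<close>;
  invertibility comes from \<open>unit_arr_iso\<close>.\<close>

lemma unit_compatibility_iff_unit_arr: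
  assumes I: "lr_unit C I" and J: "lr_unit D J" and V: "image_unit I V"
  shows "unit_compatibility C D F I J p \<longleftrightarrow> unit_arr D J V p"
proof -
  note VD = image_unitD[OF V]
  have oI: "uobj I \<in> Obj C" using I by (rule lr_unit.uobj_obj)
  have "saavedra_arr V \<cdot>\<^bsub>D\<^esub> (p \<otimes>\<^bsub>D\<^esub> p)
    = on_arr F (saavedra_arr I) \<cdot>\<^bsub>D\<^esub> (cmp F (uobj I, uobj I) \<cdot>\<^bsub>D\<^esub> (p \<otimes>\<^bsub>D\<^esub> p))"
    if "p \<in> hom D (uobj J) (uobj V)"
    unfolding VD(3)
    using D.comp_assoc[OF map_saavedra_hom[OF I] cmp_hom[OF oI oI] D.tensa_hom] that VD(2) by simp
  then show ?thesis
    using unit_arr_iso[OF J VD(1)] unit_arr_saavedra[OF J VD(1)] unit_arrI_saavedra[OF J VD(1)]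
      D.iso_hom unfolding unit_compatibility_def VD(2) by metis
qed

text \<open>Transport J along p. The compatibility equation and the fact that p is now an arrow of
  units describe the same arrow after precomposition with p \<otimes> p, and cancelling this
  isomorphism yields the Saavedra arrow.\<close>

lemma image_unit_of_unit_compatibility:
  assumes I: "lr_unit C I" and J: "lr_unit D J" and p: "unit_compatibility C D F I J p"
  obtains V where "image_unit I V"
proof -
  have oI: "uobj I \<in> Obj C" using I by (rule lr_unit.uobj_obj)
  have pi: "iso_arr D (uobj J) (on_obj F (uobj I)) p" using p by (simp add: unit_compatibility_def)
  note hp = D.iso_hom[OF pi]
  obtain V where V: "lr_unit D V" "uobj V = on_obj F (uobj I)" "unit_arr D J V p"
    using lr_unit_transport[OF J pi] .
  have "saavedra_arr V = on_arr F (saavedra_arr I) \<cdot>\<^bsub>D\<^esub> cmp F (uobj I, uobj I)"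
  proof (rule D.iso_epi[OF D.iso_tens[OF pi pi]])
    show "saavedra_arr V \<in> hom D (on_obj F (uobj I) \<odot>\<^bsub>D\<^esub> on_obj F (uobj I)) (on_obj F (uobj I))"
      using lr_unit.lam_hom[OF V(1) lr_unit.uobj_obj[OF V(1)]] V(2) by (simp add: saavedra_arr_def)
    show "on_arr F (saavedra_arr I) \<cdot>\<^bsub>D\<^esub> cmp F (uobj I, uobj I)
      \<in> hom D (on_obj F (uobj I) \<odot>\<^bsub>D\<^esub> on_obj F (uobj I)) (on_obj F (uobj I))"
      by (rule D.comp_hom[OF map_saavedra_hom[OF I] cmp_hom[OF oI oI]])
    show "saavedra_arr V \<cdot>\<^bsub>D\<^esub> (p \<otimes>\<^bsub>D\<^esub> p)
      = (on_arr F (saavedra_arr I) \<cdot>\<^bsub>D\<^esub> cmp F (uobj I, uobj I)) \<cdot>\<^bsub>D\<^esub> (p \<otimes>\<^bsub>D\<^esub> p)"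
      using unit_arr_saavedra[OF J V(1,3)] p
        D.comp_assoc[OF map_saavedra_hom[OF I] cmp_hom[OF oI oI] D.tensa_hom[OF hp hp]]
      by (simp add: unit_compatibility_def)
  qed
  with V show ?thesis using that by (simp add: image_unit_def)
qed

text \<open>The image under F of the equation \<open>unit_arr_saavedra\<close>, with F(p \<otimes>
  p) moved past the comparison by its naturality.\<close>

lemma map_unit_arr_saavedra:
  assumes I: "lr_unit C I" and I': "lr_unit C I'" and p: "unit_arr C I I' p"
  shows "on_arr F p \<cdot>\<^bsub>D\<^esub> (on_arr F (saavedra_arr I) \<cdot>\<^bsub>D\<^esub> cmp F (uobj I, uobj I))
    = on_arr F (saavedra_arr I') \<cdot>\<^bsub>D\<^esub> (cmp F (uobj I', uobj I') \<cdot>\<^bsub>D\<^esub> (on_arr F p \<otimes>\<^bsub>D\<^esub> on_arr F p))"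
proof -
  have oI: "uobj I \<in> Obj C" using I by (rule lr_unit.uobj_obj)
  note hp = unit_arr_hom[OF p]
  have a: "saavedra_arr I \<in> hom C (uobj I \<odot>\<^bsub>C\<^esub> uobj I) (uobj I)"
    using unit_arr_hom[OF saavedra_arr_unit_arr[OF I]] by (simp add: unit_tens_def)
  have a': "saavedra_arr I' \<in> hom C (uobj I' \<odot>\<^bsub>C\<^esub> uobj I') (uobj I')"
    using unit_arr_hom[OF saavedra_arr_unit_arr[OF I']] by (simp add: unit_tens_def)
  note pp = C.tensa_hom[OF hp hp]
  show ?thesis
    using cmp_nat[OF hp hp] unit_arr_saavedra[OF I I' p] map_comp[OF a' pp] map_comp[OF hp a]
      D.comp_assoc[OF arr_map[OF hp] arr_map[OF a] cmp_hom[OF oI oI]]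
      D.comp_assoc[OF arr_map[OF a'] arr_map[OF pp] cmp_hom[OF oI oI]]
    by simp
qed

lemma map_unit_arr_compatibility:
  assumes I: "lr_unit C I" and I': "lr_unit C I'" and p: "unit_arr C I I' p" and V: "image_unit I V"
  shows "unit_compatibility C D F I' V (on_arr F p)"
  using map_iso[OF unit_arr_iso[OF I I' p]] map_unit_arr_saavedra[OF I I' p] image_unitD[OF V]
  by (simp add: unit_compatibility_def)

lemma image_unit_unit_arr:
  assumes "lr_unit C I" and I': "lr_unit C I'" and "unit_arr C I I' p"
    and V: "image_unit I V" and V': "image_unit I' V'"
  shows "unit_arr D V V' (on_arr F p)"
  using map_unit_arr_compatibility[OF assms(1-4)]
    unit_compatibility_iff_unit_arr[OF I' image_unitD(1)[OF V] V'] by simp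

text \<open>An arrow p from I to I' exists by contractibility, and F(p) is a unit compatibility with
  source V, so the construction from a unit compatibility can be repeated at I'.\<close>

lemma image_unit_ex_transfer:
  assumes I: "lr_unit C I" and V: "image_unit I V" and I': "lr_unit C I'"
  obtains V' where "image_unit I' V'"
proof -
  obtain p where p: "unit_arr C I I' p" using unit_arr_ex1[OF I I'] by blast
  show ?thesis
    using image_unit_of_unit_compatibility[OF I' image_unitD(1)[OF V] map_unit_arr_compatibility[OF I I' p V]]
      that .
qed

text \<open>Only the Saavedra arrow of V is prescribed, but it determines the whole left constraint.
  After tensoring with F(I) on the left, the law \<open>lam_rho\<close> in C and in D expresses both
  sides through Saavedra arrows, and coherence of the comparison matches them.\<close>

lemma image_unit_lam:
  assumes I: "lr_unit C I" and V: "image_unit I V" and X: "X \<in> Obj C"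
  shows "lam V (on_obj F X) = on_arr F (lam I X) \<cdot>\<^bsub>D\<^esub> cmp F (uobj I, X)"
proof -
  interpret I: lr_unit C I by fact
  interpret V: lr_unit D V using image_unitD[OF V] by simp
  note uV = image_unitD(2)[OF V]
  let ?I = "uobj I" and ?FI = "on_obj F (uobj I)" and ?FX = "on_obj F X"
  let ?l = "on_arr F (lam I X)" and ?c = "cmp F (uobj I, X)"
  have oI: "?I \<in> Obj C" and oFI: "?FI \<in> Obj D" and oFX: "?FX \<in> Obj D" and oIX: "?I \<odot>\<^bsub>C\<^esub> X \<in> Obj C"
    using I.uobj_obj X obj_map C.tenso_obj by auto
  have hl: "?l \<in> hom D (on_obj F (?I \<odot>\<^bsub>C\<^esub> X)) ?FX" by (rule arr_map[OF I.lam_hom[OF X]])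
  have hc: "?c \<in> hom D (?FI \<odot>\<^bsub>D\<^esub> ?FX) (on_obj F (?I \<odot>\<^bsub>C\<^esub> X))" by (rule cmp_hom[OF oI X])
  have hlc: "?l \<cdot>\<^bsub>D\<^esub> ?c \<in> hom D (?FI \<odot>\<^bsub>D\<^esub> ?FX) ?FX" by (rule D.comp_hom[OF hl hc])
  have hlV: "lam V ?FX \<in> hom D (?FI \<odot>\<^bsub>D\<^esub> ?FX) ?FX" using V.lam_hom[OF oFX] uV by simp
  have iFI: "Id D ?FI \<in> hom D ?FI ?FI" and iFX: "Id D ?FX \<in> hom D ?FX ?FX"
    using D.id_hom oFI oFX by auto
  have a: "saavedra_arr I \<in> hom C (?I \<odot>\<^bsub>C\<^esub> ?I) ?I"
    using I.lam_hom[OF oI] by (simp add: saavedra_arr_def)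
  note cII = cmp_hom[OF oI oI]
  have "Id D ?FI \<otimes>\<^bsub>D\<^esub> (?l \<cdot>\<^bsub>D\<^esub> ?c) = Id D ?FI \<otimes>\<^bsub>D\<^esub> lam V ?FX"
  proof (rule D.iso_mono[OF cmp_iso[OF oI X] D.tensa_hom[OF iFI hlc] D.tensa_hom[OF iFI hlV]])
    have "?c \<cdot>\<^bsub>D\<^esub> (Id D ?FI \<otimes>\<^bsub>D\<^esub> (?l \<cdot>\<^bsub>D\<^esub> ?c)) = (?c \<cdot>\<^bsub>D\<^esub> (Id D ?FI \<otimes>\<^bsub>D\<^esub> ?l)) \<cdot>\<^bsub>D\<^esub> (Id D ?FI \<otimes>\<^bsub>D\<^esub> ?c)"
      using D.whisker_left[OF hl hc oFI] D.comp_assoc[OF hc D.tensa_hom[OF iFI hl] D.tensa_hom[OF iFI hc]]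
      by simp
    also have "\<dots> = on_arr F (Id C ?I \<otimes>\<^bsub>C\<^esub> lam I X) \<cdot>\<^bsub>D\<^esub> (cmp F (?I, ?I \<odot>\<^bsub>C\<^esub> X) \<cdot>\<^bsub>D\<^esub> (Id D ?FI \<otimes>\<^bsub>D\<^esub> ?c))"
      using cmp_nat[OF C.id_hom[OF oI] I.lam_hom[OF X]] map_id[OF oI]
        D.comp_assoc[OF arr_map[OF C.tensa_hom[OF C.id_hom[OF oI] I.lam_hom[OF X]]] cmp_hom[OF oI oIX] D.tensa_hom[OF iFI hc]]
      by simp
    \<comment> \<open>Here I \<otimes> \<open>lam I X\<close> becomes \<alpha> \<otimes> X, while
      associativity of the comparison regroups the remaining factors to fit.\<close>
    also have "\<dots> = on_arr F (saavedra_arr I \<otimes>\<^bsub>C\<^esub> Id C X) \<cdot>\<^bsub>D\<^esub>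
        (cmp F (?I \<odot>\<^bsub>C\<^esub> ?I, X) \<cdot>\<^bsub>D\<^esub> (cmp F (?I, ?I) \<otimes>\<^bsub>D\<^esub> Id D ?FX))"
      using cmp_assoc[OF oI oI X] I.lam_rho[OF oI X] I.lam_rho_unit by (simp add: saavedra_arr_def)
    also have "\<dots> = (?c \<cdot>\<^bsub>D\<^esub> (on_arr F (saavedra_arr I) \<otimes>\<^bsub>D\<^esub> Id D ?FX)) \<cdot>\<^bsub>D\<^esub> (cmp F (?I, ?I) \<otimes>\<^bsub>D\<^esub> Id D ?FX)"
      using cmp_nat[OF a C.id_hom[OF X]] map_id[OF X]
        D.comp_assoc[OF arr_map[OF C.tensa_hom[OF a C.id_hom[OF X]]] cmp_hom[OF C.tenso_obj[OF oI oI] X] D.tensa_hom[OF cII iFX]]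
      by simp
    also have "\<dots> = ?c \<cdot>\<^bsub>D\<^esub> (saavedra_arr V \<otimes>\<^bsub>D\<^esub> Id D ?FX)"
      using D.whisker_right[OF arr_map[OF a] cII oFX] image_unitD(3)[OF V]
        D.comp_assoc[OF hc D.tensa_hom[OF arr_map[OF a] iFX] D.tensa_hom[OF cII iFX]]
      by simp
    also have "saavedra_arr V \<otimes>\<^bsub>D\<^esub> Id D ?FX = Id D ?FI \<otimes>\<^bsub>D\<^esub> lam V ?FX"
      using V.lam_rho[OF oFI oFX] V.lam_rho_unit uV by (simp add: saavedra_arr_def)
    finally show "?c \<cdot>\<^bsub>D\<^esub> (Id D ?FI \<otimes>\<^bsub>D\<^esub> (?l \<cdot>\<^bsub>D\<^esub> ?c)) = ?c \<cdot>\<^bsub>D\<^esub> (Id D ?FI \<otimes>\<^bsub>D\<^esub> lam V ?FX)" .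
  qed
  \<comment> \<open>Tensoring with F(I) on the left is faithful because \<open>lam V\<close> is a
    natural isomorphism from it to the identity.\<close>
  then show ?thesis
    using D.iso_epi[OF V.lam_iso[OF D.tenso_obj[OF oFI oFX]], of _ ?FX] hlc hlV uV
      V.lam_nat[OF hlc] V.lam_nat[OF hlV] by metis
qed

text \<open>Makes the comparison of F available as the comparison of a lift. By
  \<open>unit_arrI_lam\<close> one left constraint equation is enough; \<open>image_unit_lam\<close>
  rewrites every constraint in it as an image under F followed by coherence of the
  comparison.\<close>

lemma image_unit_cmp:
  assumes I: "lr_unit C I" and I': "lr_unit C I'"
    and V: "image_unit I V" and V': "image_unit I' V'" and W: "image_unit (unit_tens C I I') W"
  shows "unit_arr D (unit_tens D V V') W (cmp F (uobj I, uobj I'))"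
proof -
  interpret I: lr_unit C I by fact
  interpret I': lr_unit C I' by fact
  note VD = image_unitD[OF V] and VD' = image_unitD[OF V'] and WD = image_unitD[OF W]
  note II' = unit_tens_lr_unit[OF I I']
  let ?I = "uobj I" and ?I' = "uobj I'" and ?X = "uobj I \<odot>\<^bsub>C\<^esub> uobj I'"
  let ?FI = "on_obj F ?I" and ?FX = "on_obj F ?X"
  have o: "?I \<in> Obj C" "?I' \<in> Obj C" "?X \<in> Obj C"
    using I.uobj_obj I'.uobj_obj C.tenso_obj by auto
  have IX: "?I' \<odot>\<^bsub>C\<^esub> ?X \<in> Obj C" using o C.tenso_obj by auto
  have uT: "uobj (unit_tens C I I') = ?X" by (simp add: unit_tens_def)
  have oF: "?FI \<in> Obj D" "?FX \<in> Obj D" using o obj_map by auto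
  note l = I.lam_hom[OF o(3)] and l' = I'.lam_hom[OF o(3)]
  note Il' = C.tensa_hom[OF C.id_hom[OF o(1)] l']
  note cc = cmp_hom[OF o(2,3)] and c1 = cmp_hom[OF o(1,2)] and c2 = cmp_hom[OF o(1,3)] and c3 = cmp_hom[OF o(1) IX]
  note iFI = D.id_hom[OF oF(1)] and iFX = D.id_hom[OF oF(2)]
  \<comment> \<open>Strict associativity retypes the target, so that the comparison composes with
    the image of \<open>Id C ?I\<close> \<otimes> \<open>lam I' ?X\<close>.\<close>
  have c4: "cmp F (?X, ?X) \<in> hom D (on_obj F ?X \<odot>\<^bsub>D\<^esub> ?FX) (on_obj F (?I \<odot>\<^bsub>C\<^esub> (?I' \<odot>\<^bsub>C\<^esub> ?X)))"
    using cmp_hom[OF o(3,3)] C.tenso_assoc[OF o] by simp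
  have lT: "lam (unit_tens C I I') ?X = lam I ?X \<cdot>\<^bsub>C\<^esub> (Id C ?I \<otimes>\<^bsub>C\<^esub> lam I' ?X)"
    using o by (simp add: unit_tens_def)
  show ?thesis
  proof (rule unit_arrI_lam[OF unit_tens_lr_unit[OF VD(1) VD'(1)] WD(1)])
    show "cmp F (?I, ?I') \<in> hom D (uobj (unit_tens D V V')) (uobj W)"
      using c1 VD(2) VD'(2) WD(2) uT by (simp add: unit_tens_def)
    have "lam W ?FX \<cdot>\<^bsub>D\<^esub> (cmp F (?I, ?I') \<otimes>\<^bsub>D\<^esub> Id D ?FX)
      = (on_arr F (lam I ?X) \<cdot>\<^bsub>D\<^esub> on_arr F (Id C ?I \<otimes>\<^bsub>C\<^esub> lam I' ?X)) \<cdot>\<^bsub>D\<^esub>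
        (cmp F (?X, ?X) \<cdot>\<^bsub>D\<^esub> (cmp F (?I, ?I') \<otimes>\<^bsub>D\<^esub> Id D ?FX))"
      using image_unit_lam[OF II' W o(3)] lT uT map_comp[OF l Il']
        D.comp_assoc[OF D.comp_hom[OF arr_map[OF l] arr_map[OF Il']] c4 D.tensa_hom[OF c1 iFX]] by simp
    also have "\<dots> = (on_arr F (lam I ?X) \<cdot>\<^bsub>D\<^esub> on_arr F (Id C ?I \<otimes>\<^bsub>C\<^esub> lam I' ?X)) \<cdot>\<^bsub>D\<^esub>
        (cmp F (?I, ?I' \<odot>\<^bsub>C\<^esub> ?X) \<cdot>\<^bsub>D\<^esub> (Id D ?FI \<otimes>\<^bsub>D\<^esub> cmp F (?I', ?X)))"
      using cmp_assoc[OF o] by simp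
    also have "\<dots> = on_arr F (lam I ?X) \<cdot>\<^bsub>D\<^esub>
        ((on_arr F (Id C ?I \<otimes>\<^bsub>C\<^esub> lam I' ?X) \<cdot>\<^bsub>D\<^esub> cmp F (?I, ?I' \<odot>\<^bsub>C\<^esub> ?X)) \<cdot>\<^bsub>D\<^esub> (Id D ?FI \<otimes>\<^bsub>D\<^esub> cmp F (?I', ?X)))"
      using D.comp_assoc[OF arr_map[OF l] arr_map[OF Il'] D.comp_hom[OF c3 D.tensa_hom[OF iFI cc]]]
        D.comp_assoc[OF arr_map[OF Il'] c3 D.tensa_hom[OF iFI cc]] by simp
    also have "\<dots> = on_arr F (lam I ?X) \<cdot>\<^bsub>D\<^esub>
        ((cmp F (?I, ?X) \<cdot>\<^bsub>D\<^esub> (Id D ?FI \<otimes>\<^bsub>D\<^esub> on_arr F (lam I' ?X))) \<cdot>\<^bsub>D\<^esub> (Id D ?FI \<otimes>\<^bsub>D\<^esub> cmp F (?I', ?X)))"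
      using cmp_nat[OF C.id_hom[OF o(1)] l'] map_id[OF o(1)] by simp
    also have "\<dots> = (on_arr F (lam I ?X) \<cdot>\<^bsub>D\<^esub> cmp F (?I, ?X)) \<cdot>\<^bsub>D\<^esub>
        (Id D ?FI \<otimes>\<^bsub>D\<^esub> (on_arr F (lam I' ?X) \<cdot>\<^bsub>D\<^esub> cmp F (?I', ?X)))"
      using D.whisker_left[OF arr_map[OF l'] cc oF(1)]
        D.comp_assoc[OF c2 D.tensa_hom[OF iFI arr_map[OF l']] D.tensa_hom[OF iFI cc]]
        D.comp_assoc[OF arr_map[OF l] c2 D.tensa_hom[OF iFI D.comp_hom[OF arr_map[OF l'] cc]]] by simp
    also have "\<dots> = lam (unit_tens D V V') ?FX"
      using image_unit_lam[OF I V o(3)] image_unit_lam[OF I' V' o(3)] VD(2) oF by (simp add: unit_tens_def)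
    finally show "lam W (uobj W) \<cdot>\<^bsub>D\<^esub> (cmp F (?I, ?I') \<otimes>\<^bsub>D\<^esub> Id D (uobj W)) = lam (unit_tens D V V') (uobj W)"
      using WD(2) uT by simp
  qed
qed

section \<open>Lifts: their values, uniqueness and existence\<close>

lemma lifts_values:
  assumes L: "L \<in> lifts C D F" and U: "lr_unit C U" and V: "lr_unit C V"
  shows "lr_unit D (on_obj L U)" "uobj (on_obj L U) = on_obj F (uobj U)"
    and "unit_arr C U V p \<Longrightarrow> on_arr L (U, p, V) = (on_obj L U, on_arr F p, on_obj L V)"
    and "unit_arr C U V p \<Longrightarrow> unit_arr D (on_obj L U) (on_obj L V) (on_arr F p)"
    and "cmp L (U, V) = (unit_tens D (on_obj L U) (on_obj L V), cmp F (uobj U, uobj V), on_obj L (unit_tens C U V))"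
    and "unit_arr D (unit_tens D (on_obj L U) (on_obj L V)) (on_obj L (unit_tens C U V)) (cmp F (uobj U, uobj V))"
proof -
  interpret L: strong_mult_functor "units C" "units D" L using L by (simp add: lifts_def)
  \<comment> \<open>The square is evaluated on objects, arrows and comparisons in turn. Forgetting
    retains the underlying objects and arrows, so F fixes those, and only the unit structures on the
    objects \<open>on_obj L U\<close> remain open.\<close>
  have sq: "mult_fun_comp (units C) D (forgetful D) L = mult_fun_comp (units C) D F (forgetful C)"
    using L by (simp add: lifts_def)
  have obU: "W \<in> Obj (units C) \<longleftrightarrow> lr_unit C W" for W by (simp add: units_def)
  have obD: "W \<in> Obj (units D) \<longleftrightarrow> lr_unit D W" for W by (simp add: units_def)
  have lr: "lr_unit D (on_obj L W)" if "lr_unit C W" for W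
    using L.obj_map[of W] that by (simp add: obU obD)
  have u: "uobj (on_obj L W) = on_obj F (uobj W)" if "lr_unit C W" for W
  proof -
    have "on_obj (mult_fun_comp (units C) D (forgetful D) L) W
      = on_obj (mult_fun_comp (units C) D F (forgetful C)) W" by (simp add: sq)
    then show ?thesis using that lr[OF that] by (simp add: mult_fun_comp_def forgetful_def obU obD)
  qed
  show "lr_unit D (on_obj L U)" "uobj (on_obj L U) = on_obj F (uobj U)" using U by (simp_all add: lr u)
  have *: "on_arr L (U, p, V) = (on_obj L U, on_arr F p, on_obj L V)
      \<and> unit_arr D (on_obj L U) (on_obj L V) (on_arr F p)" if p: "unit_arr C U V p"
  proof -
    have h: "(U, p, V) \<in> hom (units C) U V" using U V p by (simp add: units_hom)
    obtain q where q: "on_arr L (U, p, V) = (on_obj L U, q, on_obj L V)" "unit_arr D (on_obj L U) (on_obj L V) q"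
      using L.arr_map[OF h] by (auto simp: units_hom)
    have hC: "(U, p, V) \<in> Arr (units C)" using h by (simp add: hom_def)
    \<comment> \<open>Membership comes first because \<open>on_arr (forgetful D)\<close> is
      \<open>undefined\<close> off \<open>Arr (units D)\<close>.\<close>
    have hD: "on_arr L (U, p, V) \<in> Arr (units D)" using L.arr_map[OF h] by (simp add: hom_def)
    have "on_arr (mult_fun_comp (units C) D (forgetful D) L) (U, p, V)
      = on_arr (mult_fun_comp (units C) D F (forgetful C)) (U, p, V)" by (simp add: sq)
    then have "q = on_arr F p" using hC hD q(1) by (simp add: mult_fun_comp_def forgetful_def)
    with q show ?thesis by simp
  qed
  show "unit_arr C U V p \<Longrightarrow> on_arr L (U, p, V) = (on_obj L U, on_arr F p, on_obj L V)"
    "unit_arr C U V p \<Longrightarrow> unit_arr D (on_obj L U) (on_obj L V) (on_arr F p)"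
    using * by auto
  have h: "cmp L (U, V) \<in> hom (units D) (unit_tens D (on_obj L U) (on_obj L V)) (on_obj L (unit_tens C U V))"
    using L.cmp_iso[of U V] U V by (simp add: obU iso_arr_def) (simp add: units_def)
  then obtain q where q: "cmp L (U, V) = (unit_tens D (on_obj L U) (on_obj L V), q, on_obj L (unit_tens C U V))"
      "unit_arr D (unit_tens D (on_obj L U) (on_obj L V)) (on_obj L (unit_tens C U V)) q"
    by (auto simp: units_hom)
  have hD: "cmp L (U, V) \<in> Arr (units D)" using h by (simp add: hom_def)
  have "cmp (mult_fun_comp (units C) D (forgetful D) L) (U, V)
    = cmp (mult_fun_comp (units C) D F (forgetful C)) (U, V)" by (simp add: sq)
  \<comment> \<open>The identities are the comparisons of the two strict forgetful functors; once
    they are removed, q is the comparison of F.\<close>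
  then have e: "q \<cdot>\<^bsub>D\<^esub> Id D (on_obj F (uobj U) \<odot>\<^bsub>D\<^esub> on_obj F (uobj V))
    = on_arr F (Id C (uobj U \<odot>\<^bsub>C\<^esub> uobj V)) \<cdot>\<^bsub>D\<^esub> cmp F (uobj U, uobj V)"
    using U V hD q(1) lr u by (simp add: mult_fun_comp_def forgetful_def obU obD)
  have oU: "uobj U \<in> Obj C" "uobj V \<in> Obj C" using U V lr_unit.uobj_obj by auto
  have "q \<in> hom D (on_obj F (uobj U) \<odot>\<^bsub>D\<^esub> on_obj F (uobj V)) (on_obj F (uobj U \<odot>\<^bsub>C\<^esub> uobj V))"
    using unit_arr_hom[OF q(2)] u U V u[OF unit_tens_lr_unit[OF U V]] by (simp add: unit_tens_def)
  from D.id_right[OF this] e D.id_left[OF cmp_hom[OF oU]]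
  have "q = cmp F (uobj U, uobj V)" using oU C.tenso_obj by (simp add: map_id)
  with q show "cmp L (U, V) = (unit_tens D (on_obj L U) (on_obj L V), cmp F (uobj U, uobj V), on_obj L (unit_tens C U V))"
    "unit_arr D (unit_tens D (on_obj L U) (on_obj L V)) (on_obj L (unit_tens C U V)) (cmp F (uobj U, uobj V))"
    by simp_all
qed

text \<open>
  Since \<open>\<alpha> : II \<rightarrow> I\<close> is an arrow of units, a lift makes \<open>F(\<alpha>) \<circ> \<phi>\<close> an arrow of units
  \<open>L(I) L(I) \<rightarrow> L(I)\<close>, and the Saavedra arrow of \<open>L(I)\<close> is the only such arrow.
\<close>

lemma lifts_image_unit:
  assumes L: "L \<in> lifts C D F" and U: "lr_unit C U"
  shows "image_unit U (on_obj L U)"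
proof -
  note UU = unit_tens_lr_unit[OF U U]
  note LU = lifts_values(1)[OF L U U] and LUU = lifts_values(1)[OF L UU UU]
  note TT = unit_tens_lr_unit[OF LU LU]
  have "unit_arr D (unit_tens D (on_obj L U) (on_obj L U)) (on_obj L U)
      (on_arr F (saavedra_arr U) \<cdot>\<^bsub>D\<^esub> cmp F (uobj U, uobj U))"
    by (rule unit_arr_comp[OF TT LUU LU lifts_values(4)[OF L UU U saavedra_arr_unit_arr[OF U]]
          lifts_values(6)[OF L U U]])
  from unit_arr_unique[OF TT LU saavedra_arr_unit_arr[OF LU] this]
  show ?thesis using LU lifts_values(2)[OF L U U] by (simp add: image_unit_def)
qed

text \<open>\<open>lifts_image_unit\<close> pins down the unit structures left open by the square;
  \<open>lifts_values\<close> then fixes arrows and comparisons.\<close>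

lemma lifts_unique:
  assumes L: "L \<in> lifts C D F" and L': "L' \<in> lifts C D F"
  shows "L = L'"
proof -
  interpret L: strong_mult_functor "units C" "units D" L using L by (simp add: lifts_def)
  interpret L': strong_mult_functor "units C" "units D" L' using L' by (simp add: lifts_def)
  have o: "on_obj L U = on_obj L' U" if "lr_unit C U" for U
    using image_unit_unique lifts_image_unit[OF L that] lifts_image_unit[OF L' that] .
  have "on_obj L = on_obj L'"
    by (rule extensionalityI[OF L.obj_ext L'.obj_ext]) (simp add: units_def o)
  moreover have "on_arr L = on_arr L'"
    by (rule extensionalityI[OF L.arr_ext L'.arr_ext])
      (auto simp: units_def o lifts_values(3)[OF L] lifts_values(3)[OF L'])
  moreover have "cmp L = cmp L'"
    by (rule extensionalityI[OF L.cmp_ext L'.cmp_ext])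
      (auto simp: units_def o lifts_values(5)[OF L] lifts_values(5)[OF L'] unit_tens_lr_unit)
  ultimately show ?thesis by (simp add: mult_fun.equality)
qed

text \<open>
  All axioms for the lift constructed here are equations between parallel arrows of the contractible
  category \<open>units D\<close>, so only the well-typedness of its values requires an argument.
\<close>

lemma lifts_nonempty:
  assumes ex: "\<And>U. lr_unit C U \<Longrightarrow> \<exists>V. image_unit U V"
  shows "lifts C D F \<noteq> {}"
proof -
  interpret UC: semi_monoidal_category "units C" by (rule units_semi_monoidal) unfold_locales
  interpret UD: semi_monoidal_category "units D" by (rule units_semi_monoidal) unfold_locales
  define T where "T U = (SOME V. image_unit U V)" for U
  have T: "image_unit U (T U)" if "lr_unit C U" for U
    unfolding T_def using ex[OF that] by (rule someI_ex)
  note TD = image_unitD[OF T]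
  define L where "L = \<lparr>on_obj = (\<lambda>U \<in> Obj (units C). T U),
      on_arr = (\<lambda>(U, p, V) \<in> Arr (units C). (T U, on_arr F p, T V)),
      cmp = (\<lambda>(U, V) \<in> Obj (units C) \<times> Obj (units C).
        (unit_tens D (T U) (T V), cmp F (uobj U, uobj V), T (unit_tens C U V)))\<rparr>"
  have obU: "W \<in> Obj (units C) \<longleftrightarrow> lr_unit C W" and obD: "W' \<in> Obj (units D) \<longleftrightarrow> lr_unit D W'" for W W'
    by (simp_all add: units_def)
  have tC: "tenso (units C) = unit_tens C" and tD: "tenso (units D) = unit_tens D"
    by (simp_all add: units_def)
  have Lo: "on_obj L U = T U" if "lr_unit C U" for U
    using that by (simp add: L_def obU)
  have La: "on_arr L (U, p, V) = (T U, on_arr F p, T V)" if "lr_unit C U" "lr_unit C V" "unit_arr C U V p" for U p V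
    using that by (simp add: L_def units_def)
  have Lc: "cmp L (U, V) = (unit_tens D (T U) (T V), cmp F (uobj U, uobj V), T (unit_tens C U V))"
    if "lr_unit C U" "lr_unit C V" for U V
    using that by (simp add: L_def obU)
  have par: "f = g" if "f \<in> hom (units D) V W" "g \<in> hom (units D) V W" for f g V W
    using that unit_arr_unique by (auto simp: units_hom)
  have iso: "iso_arr (units D) V W f" if f: "f \<in> hom (units D) V W" for f V W
  proof -
    have VW: "V \<in> Obj (units D)" "W \<in> Obj (units D)" using UD.hom_objD[OF f] by auto
    obtain g where g: "g \<in> hom (units D) W V" using units_contractible VW obD by blast
    show ?thesis unfolding iso_arr_def
      using f g par[OF UD.comp_hom[OF g f] UD.id_hom[OF VW(1)]] par[OF UD.comp_hom[OF f g] UD.id_hom[OF VW(2)]]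
      by blast
  qed
  have ho: "on_obj L U \<in> Obj (units D)" if "U \<in> Obj (units C)" for U
    using that TD(1) by (simp add: Lo obU obD)
  have ha: "on_arr L f \<in> hom (units D) (on_obj L U) (on_obj L V)" if "f \<in> hom (units C) U V" for f U V
    using that by (auto simp: units_hom La Lo TD intro!: image_unit_unit_arr T)
  have hc: "cmp L (U, V) \<in> hom (units D) (on_obj L U \<odot>\<^bsub>units D\<^esub> on_obj L V) (on_obj L (U \<odot>\<^bsub>units C\<^esub> V))"
    if "U \<in> Obj (units C)" "V \<in> Obj (units C)" for U V
    using that by (auto simp: units_hom Lc Lo obU tC tD TD unit_tens_lr_unit intro!: image_unit_cmp T)
  have "strong_mult_functor (units C) (units D) L"
  proof unfold_locales
    show "on_obj L \<in> extensional (Obj (units C))" "on_arr L \<in> extensional (Arr (units C))"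
      "cmp L \<in> extensional (Obj (units C) \<times> Obj (units C))"
      by (simp_all add: L_def)
    show "U \<in> Obj (units C) \<Longrightarrow> on_obj L U \<in> Obj (units D)" for U by (rule ho)
    show "f \<in> hom (units C) U V \<Longrightarrow> on_arr L f \<in> hom (units D) (on_obj L U) (on_obj L V)" for f U V by (rule ha)
    show "on_arr L (Id (units C) U) = Id (units D) (on_obj L U)" if "U \<in> Obj (units C)" for U
      by (rule par[OF ha[OF UC.id_hom] UD.id_hom[OF ho]]) fact+
    show "on_arr L (g \<cdot>\<^bsub>units C\<^esub> f) = on_arr L g \<cdot>\<^bsub>units D\<^esub> on_arr L f"
      if "g \<in> hom (units C) V W" "f \<in> hom (units C) U V" for g f U V W
      by (rule par[OF ha[OF UC.comp_hom] UD.comp_hom[OF ha ha]]) fact+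
    show "iso_arr (units D) (on_obj L U \<odot>\<^bsub>units D\<^esub> on_obj L V) (on_obj L (U \<odot>\<^bsub>units C\<^esub> V)) (cmp L (U, V))"
      if "U \<in> Obj (units C)" "V \<in> Obj (units C)" for U V
      using that by (intro iso hc)
    show "cmp L (U', V') \<cdot>\<^bsub>units D\<^esub> (on_arr L f \<otimes>\<^bsub>units D\<^esub> on_arr L g)
      = on_arr L (f \<otimes>\<^bsub>units C\<^esub> g) \<cdot>\<^bsub>units D\<^esub> cmp L (U, V)"
      if f: "f \<in> hom (units C) U U'" and g: "g \<in> hom (units C) V V'" for f g U V U' V'
    proof -
      have "U \<in> Obj (units C)" "U' \<in> Obj (units C)" "V \<in> Obj (units C)" "V' \<in> Obj (units C)"
        using UC.hom_objD[OF f] UC.hom_objD[OF g] by auto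
      then show ?thesis
        by (intro par[OF UD.comp_hom[OF hc UD.tensa_hom[OF ha[OF f] ha[OF g]]]
              UD.comp_hom[OF ha[OF UC.tensa_hom[OF f g]] hc]])
    qed
    show "cmp L (U \<odot>\<^bsub>units C\<^esub> V, W) \<cdot>\<^bsub>units D\<^esub> (cmp L (U, V) \<otimes>\<^bsub>units D\<^esub> Id (units D) (on_obj L W))
      = cmp L (U, V \<odot>\<^bsub>units C\<^esub> W) \<cdot>\<^bsub>units D\<^esub> (Id (units D) (on_obj L U) \<otimes>\<^bsub>units D\<^esub> cmp L (V, W))"
      if U: "U \<in> Obj (units C)" and V: "V \<in> Obj (units C)" and W: "W \<in> Obj (units C)" for U V W
    proof -
      note UV = UC.tenso_obj[OF U V] and VW = UC.tenso_obj[OF V W]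
      \<comment> \<open>Strict associativity in both categories of units makes the two composites
        parallel.\<close>
      have "cmp L (U, V \<odot>\<^bsub>units C\<^esub> W) \<cdot>\<^bsub>units D\<^esub> (Id (units D) (on_obj L U) \<otimes>\<^bsub>units D\<^esub> cmp L (V, W))
        \<in> hom (units D) ((on_obj L U \<odot>\<^bsub>units D\<^esub> on_obj L V) \<odot>\<^bsub>units D\<^esub> on_obj L W)
            (on_obj L ((U \<odot>\<^bsub>units C\<^esub> V) \<odot>\<^bsub>units C\<^esub> W))"
        using UD.comp_hom[OF hc[OF U VW] UD.tensa_hom[OF UD.id_hom[OF ho[OF U]] hc[OF V W]]]
        by (simp only: UC.tenso_assoc[OF U V W] UD.tenso_assoc[OF ho[OF U] ho[OF V] ho[OF W]])
      with UD.comp_hom[OF hc[OF UV W] UD.tensa_hom[OF hc[OF U V] UD.id_hom[OF ho[OF W]]]]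
      show ?thesis by (rule par)
    qed
  qed
  moreover have "mult_fun_comp (units C) D (forgetful D) L = mult_fun_comp (units C) D F (forgetful C)"
  proof (rule mult_fun.equality)
    show "on_obj (mult_fun_comp (units C) D (forgetful D) L) = on_obj (mult_fun_comp (units C) D F (forgetful C))"
      by (auto simp: mult_fun_comp_def forgetful_def obU obD Lo TD restrict_def fun_eq_iff)
    show "on_arr (mult_fun_comp (units C) D (forgetful D) L) = on_arr (mult_fun_comp (units C) D F (forgetful C))"
    proof -
      have "on_arr (forgetful D) (on_arr L f) = on_arr F (on_arr (forgetful C) f)" if f: "f \<in> Arr (units C)" for f
      proof -
        obtain U p V where f': "f = (U, p, V)" "lr_unit C U" "lr_unit C V" "unit_arr C U V p"
          using f by (auto simp: units_def)
        have "on_arr L f \<in> Arr (units D)" using UD.hom_arr[OF ha[of f U V]] f' by (simp add: units_hom)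
        then show ?thesis using f f' by (simp add: forgetful_def La)
      qed
      then show ?thesis by (auto simp: mult_fun_comp_def restrict_def fun_eq_iff)
    qed
    show "cmp (mult_fun_comp (units C) D (forgetful D) L) = cmp (mult_fun_comp (units C) D F (forgetful C))"
    proof -
      have "on_arr (forgetful D) (cmp L (U, V)) \<cdot>\<^bsub>D\<^esub> cmp (forgetful D) (on_obj L U, on_obj L V)
        = on_arr F (cmp (forgetful C) (U, V)) \<cdot>\<^bsub>D\<^esub> cmp F (on_obj (forgetful C) U, on_obj (forgetful C) V)"
        if U: "U \<in> Obj (units C)" and V: "V \<in> Obj (units C)" for U V
      proof -
        have o: "uobj U \<in> Obj C" "uobj V \<in> Obj C" using U V by (auto simp: obU lr_unit.uobj_obj)
        have "cmp L (U, V) \<in> Arr (units D)" using hc[OF U V] by (simp add: hom_def)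
        then show ?thesis
          using U V o D.id_right[OF cmp_hom[OF o]] D.id_left[OF cmp_hom[OF o]]
          by (simp add: forgetful_def Lc Lo obU obD TD map_id C.tenso_obj)
      qed
      then show ?thesis by (auto simp: mult_fun_comp_def restrict_def fun_eq_iff)
    qed
  qed simp
  ultimately show ?thesis by (auto simp: lifts_def)
qed

section \<open>Families of unit compatibilities\<close>

lemma lift_family_unit_arr:
  assumes L: "L \<in> lifts C D F" and I: "lr_unit C I" and J: "lr_unit D J"
  shows "unit_arr D J (on_obj L I) (lift_family C D L (I, J))"
proof -
  let ?f = "THE f. f \<in> hom (units D) J (on_obj L I)"
  \<comment> \<open>The description denotes because the category of units is contractible.\<close>
  have f: "?f \<in> hom (units D) J (on_obj L I)"
    by (rule theI'[OF units_contractible[OF J lifts_values(1)[OF L I I]]])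
  then obtain p where p: "?f = (J, p, on_obj L I)" "unit_arr D J (on_obj L I) p"
    by (auto simp: units_hom)
  have "?f \<in> Arr (units D)" using f by (simp add: hom_def)
  then have "lift_family C D L (I, J) = p"
    using I J p(1) by (simp add: lift_family_def forgetful_def) (simp add: units_def)
  with p(2) show ?thesis by simp
qed

text \<open>The members are arrows of units into \<open>on_obj L I\<close>, which is the image unit
  of I, and such arrows are unit compatibilities.\<close>

lemma lift_family_compatibility:
  assumes L: "L \<in> lifts C D F"
  shows "lift_family C D L \<in> compatibility_families C D F"
proof -
  have "unit_compatibility C D F I J (lift_family C D L (I, J))" if I: "lr_unit C I" and J: "lr_unit D J" for I J
    using unit_compatibility_iff_unit_arr[OF I J lifts_image_unit[OF L I]] lift_family_unit_arr[OF L I J] by simp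
  moreover have "lift_family C D L \<in> extensional (Obj (units C) \<times> Obj (units D))"
    by (simp add: lift_family_def)
  ultimately show ?thesis
    by (auto simp: compatibility_families_def PiE_iff units_def)
qed

text \<open>At each pair both members are arrows of units from J to the same image unit, so
  contractibility makes them equal.\<close>

lemma compatibility_families_unique:
  assumes ex: "\<And>I. lr_unit C I \<Longrightarrow> \<exists>V. image_unit I V"
    and p: "p \<in> compatibility_families C D F" and q: "q \<in> compatibility_families C D F"
  shows "p = q"
proof (rule PiE_ext[OF p[unfolded compatibility_families_def] q[unfolded compatibility_families_def]])
  fix x assume x: "x \<in> Obj (units C) \<times> Obj (units D)"
  then obtain I J where IJ: "x = (I, J)" "lr_unit C I" "lr_unit D J" by (auto simp: units_def)
  obtain V where V: "image_unit I V" using ex IJ(2) by blast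
  have "unit_compatibility C D F I J (p x)" "unit_compatibility C D F I J (q x)"
    using p q x IJ(1) by (auto simp: compatibility_families_def PiE_iff)
  then show "p x = q x"
    using unit_compatibility_iff_unit_arr[OF IJ(2,3) V] unit_arr_unique[OF IJ(3) image_unitD(1)[OF V]] by blast
qed

end

theorem proposition3p17:
  fixes C :: "('o, 'a) smcat" and D :: "('p, 'b) smcat" and F :: "('o, 'a, 'p, 'b) mult_fun"
  assumes "monoidal_category C" and "monoidal_category D"
    and "strong_mult_functor C D F"
    and "\<exists>I \<in> Obj (units C). \<exists>J \<in> Obj (units D). \<exists>p. unit_compatibility C D F I J p"
  shows "bij_betw (lift_family C D) (lifts C D F) (compatibility_families C D F)"
proof -
  interpret strong_functor_semi_monoidal C D F
    using assms by (auto simp: strong_functor_semi_monoidal_def monoidal_category_def)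
  obtain I J p where I: "lr_unit C I" and J: "lr_unit D J" and p: "unit_compatibility C D F I J p"
    using assms(4) by (auto simp: units_def)
  obtain V where V: "image_unit I V" using image_unit_of_unit_compatibility[OF I J p] .
  \<comment> \<open>The one given compatibility yields an image unit at I, which spreads along
    arrows of units to every unit of C.\<close>
  have ex: "\<exists>W. image_unit U W" if U: "lr_unit C U" for U
    using image_unit_ex_transfer[OF I V U] by blast
  obtain L where L: "L \<in> lifts C D F" using lifts_nonempty[OF ex] by blast
  have "lifts C D F = {L}" using L lifts_unique by blast
  moreover have "compatibility_families C D F = {lift_family C D L}"
    using lift_family_compatibility[OF L] compatibility_families_unique[OF ex] by blast
  ultimately show ?thesis by (simp add: bij_betw_def)
qed

end
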